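(* Let $X$ be a finite set, $P$ an irreducible row-stochastic matrix on $X$, and $\{A_i\}_{i\in X}\subset \mathrm{GL}_2(\mathbb R)$ a family which is projectively uniformly hyperbolic with respect to $\Sigma$. Fix a multicone $\{M_i\}_{i\in X}$, local charts $L_{i,a}$, a recurrent class $C$, and carry out the construction described in the context (including the aperiodic reduction), obtaining $C,\ Q,\ \pi,\ B_r,\ f_r,\ \ell_r,\ \mathrm T,\ \boldsymbol v$ and the period $d$. Then \[ \lambda_+(A,P)\;=\;\sum_{n=0}^\infty \big[\mathrm T^n\widehat{\boldsymbol v}\big]_{\boldsymbol 0},\qquad \widehat{\boldsymbol v}=\frac1d\,\boldsymbol v . \]
   Context: Markov setting. $X$ is a finite set and $P=(P_{ij})_{i,j\in X}$ is row-stochastic and irreducible (for all $i,j$ there is $n\ge 1$ with $(P^n)_{ij}>0$). $\Sigma=\{x=(x_n)_{n\ge0}\in X^{\mathbb N_0}: P_{x_nx_{n+1}}>0\ \forall n\}$; $p$ is the unique stationary probability vector of $P$; $\mu$ is the Markov measure on $\Sigma$, $\mu([i_0,\dots,i_n])=p_{i_0}P_{i_0i_1}\cdots P_{i_{n-1}i_n}$. With $A^n(x)=A_{x_{n-1}}\cdots A_{x_0}$, $\lambda_+(A,P)$ is the $\mu$-a.e. constant value of $\lim_n\frac1n\log\|A^n(x)\|$. Projective uniform hyperbolicity: let $\widehat\Sigma=\{(x_n)_{n\in\mathbb Z}: P_{x_nx_{n+1}}>0\ \forall n\}$ with left shift $\widehat\sigma$. The family is projectively uniformly hyperbolic w.r.t.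 $\Sigma$ if there is a continuous splitting $\mathbb R^2=E^d(\hat x)\oplus E^w(\hat x)$ into lines ($\hat x\in\widehat\Sigma$) with $A_{x_0}E^{*}(\hat x)=E^{*}(\widehat\sigma\hat x)$ for $*\in\{d,w\}$, and some $n\ge1$ with $\|A_{x_{n-1}}\cdots A_{x_0}|_{E^w(\hat x)}\|<\|A_{x_{n-1}}\cdots A_{x_0}|_{E^d(\hat x)}\|$ for all $\hat x$. Multicone: $\mathbb{RP}^1$ is the real projective line, $[G]$ the projective action of $G\in\mathrm{GL}_2(\mathbb R)$. A multicone is a family $\{M_i\}_{i\in X}$ of non-empty proper subsets of $\mathbb{RP}^1$, each a finite union of open intervals, with $\overline{[A_j](M_i)}\subset M_j$ whenever $P_{ij}>0$ (one exists under projective uniform hyperbolicity). Branch states: write $M_i=\bigsqcup_{a=1}^{m(i)}M_{i,a}$ (connected components). For $P_{ij}>0$, $\beta(i,a,j)$ is the unique $b$ with $[A_j](\overline{M_{i,a}})\subset M_{j,b}$. $R=\{((i,a),(j,b)): P_{ij}>0,\ 1\le a\le m(i),\ b=\beta(i,a,j)\}$; for $r=((i,a),(j,b))$ put $s(r)=(i,a)$, $t(r)=(j,b)$, $\tau(r)=j$. $Q_{r,r'}=P_{\tau(r)\tau(r')}$ if $t(r)=s(r')$ and $0$ otherwise. A recurrent class is $C\subset R$ with $Q|_C$ irreducible and ($r\in C$, $Q_{r,r'}>0\Rightarrow r'\in C$); fix one. Local matrices: let $\mathcal V\subset\mathbb{RP}^1$ be the set of classes of non-zero vectors with non-negative entries.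 For each $(i,a)$ fix $L_{i,a}\in\mathrm{GL}_2(\mathbb R)$ with $[L_{i,a}](\mathcal V)=\overline{M_{i,a}}$. For $r\in C$ let $B_r=\varepsilon(r)L_{t(r)}^{-1}A_{\tau(r)}L_{s(r)}$ with $\varepsilon(r)\in\{\pm1\}$ chosen so that $B_r$ has all entries positive. Aperiodic reduction: $d$ is the period of $Q|_C$ ($\gcd\{n\ge1:(Q|_C^n)_{rr}>0\}$). If $d>1$, fix $r_*\in C$, let $C_u$ ($u\in\mathbb Z/d$) be the set of states reachable from $r_*$ in a number of steps $\equiv u \pmod d$, and replace $C$ by $\{(c_0,\dots,c_{d-1}): c_u\in C_u,\ Q_{c_uc_{u+1}}>0\}$, $Q$ by $Q_{c,c'}=Q_{c_{d-1}c'_0}Q_{c'_0c'_1}\cdots Q_{c'_{d-2}c'_{d-1}}$, and $B$ by $B_c=B_{c_{d-1}}\cdots B_{c_0}$. After this (trivial if $d=1$) we keep the names $C,Q,B_r$; $Q|_C$ is irreducible and aperiodic, $\pi=(\pi_r)_{r\in C}$ is its stationary probability vector ($\pi_r>0$), each $B_r$ is entrywise positive; $d$ always denotes the period before the replacement. Möbius data: for $B_r=\begin{pmatrix}a_r&b_r\\c_r&d_r\end{pmatrix}$ put $\begin{pmatrix}\alpha_r&\beta_r\\\gamma_r&\delta_r\end{pmatrix}=\frac12\begin{pmatrix}a_r-b_r-c_r+d_r& a_r+b_r-c_r-d_r\\ a_r-b_r+c_r-d_r& a_r+b_r+c_r+d_r\end{pmatrix}$, $f_r(x)=\frac{\alpha_rx+\beta_r}{\gamma_rx+\delta_r}$,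 $f_r^\top(x)=\frac{\alpha_rx+\gamma_r}{\beta_rx+\delta_r}$ (so $f_r^\top(0)=\gamma_r/\delta_r$, and $|f_r^\top(0)|<1$), $f_r'$ the derivative, and $\ell_r(x)=\mathrm{Log}(\gamma_rx+\delta_r)$ (principal branch). Operators: $T_r=(b^{(r)}_{k,n})_{k,n\ge0}$ with $b^{(r)}_{k,0}=0$ ($k\ge0$), $b^{(r)}_{0,n}=(f_r^\top(0))^n$ ($n\ge1$), and for $k,n\ge1$: $b^{(r)}_{k,n}=\sum_{\ell=1}^{\min\{k,n\}}\binom n\ell\binom{k-1}{\ell-1}(f_r^\top(0))^{n-\ell}(-f_r(0))^{k-\ell}(f_r'(0))^\ell$. For $|x|\le1$, $c\in\mathbb C$, $v(x;c)\in\ell^\infty(\mathbb N_0)$ has $0$-th entry $c$ and $n$-th entry $-(-x)^n/n$ ($n\ge1$); $V$ is the linear span of these vectors, and $T_r$ acts on $V$ by $(T_ru)_k=\sum_n b^{(r)}_{k,n}u_n$ (absolutely convergent, $T_r(V)\subset V$). On $V_C=\bigoplus_{r\in C}V$, $(\mathrm T\boldsymbol u)_{r'}=\sum_{r\in C}\frac{\pi_rQ_{r,r'}}{\pi_{r'}}T_ru_r$. The seed $\boldsymbol v\in V_C$ is $\boldsymbol v_s=\sum_{r\in C}\frac{\pi_rQ_{r,s}}{\pi_s}v(f_r(0);\ell_r(0))$, and for $\boldsymbol w=(w_r)_{r\in C}$, $[\boldsymbol w]_{\boldsymbol 0}=\sum_{r\in C}\pi_r(w_r)_0$. *)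

theory Defs
  imports "HOL-Probability.Probability"
begin

typedef rp1 = "{S :: (real^2) set. subspace S \<and> dim S = 1}"
proof
  have "(axis 1 (1::real) :: real^2) \<noteq> 0" by (simp add: axis_eq_0_iff)
  then show "span {axis 1 (1::real) :: real^2} \<in> {S. subspace S \<and> dim S = 1}"
    by (simp add: dim_span dim_insert)
qed

definition rp1_of :: "real^2 \<Rightarrow> rp1" where
  "rp1_of v = Abs_rp1 (span {v})"

instantiation rp1 :: topological_space
begin
definition open_rp1 :: "rp1 set \<Rightarrow> bool" where
  "open_rp1 U \<longleftrightarrow> open {v :: real^2. v \<noteq> 0 \<and> rp1_of v \<in> U}"
instance
proof
  have "{v :: real^2. v \<noteq> 0 \<and> rp1_of v \<in> UNIV} = - {0}" by auto
  then show "open (UNIV :: rp1 set)" unfolding open_rp1_def by (simp add: open_Compl)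
next
  fix S T :: "rp1 set"
  assume "open S" "open T"
  moreover have "{v :: real^2. v \<noteq> 0 \<and> rp1_of v \<in> S \<inter> T}
      = {v. v \<noteq> 0 \<and> rp1_of v \<in> S} \<inter> {v. v \<noteq> 0 \<and> rp1_of v \<in> T}" by auto
  ultimately show "open (S \<inter> T)" unfolding open_rp1_def by (simp add: open_Int)
next
  fix K :: "rp1 set set"
  assume "\<forall>S\<in>K. open S"
  moreover have "{v :: real^2. v \<noteq> 0 \<and> rp1_of v \<in> \<Union>K}
      = (\<Union>S\<in>K. {v. v \<noteq> 0 \<and> rp1_of v \<in> S})" by auto
  ultimately show "open (\<Union>K)" unfolding open_rp1_def by (auto intro: open_UN)
qed
end

definition proj_act :: "real^2^2 \<Rightarrow> rp1 \<Rightarrow> rp1" where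
  "proj_act G l = Abs_rp1 ((\<lambda>v. G *v v) ` Rep_rp1 l)"

definition Vnonneg :: "rp1 set" where
  "Vnonneg = {rp1_of v | v. v \<noteq> 0 \<and> (\<forall>i. v $ i \<ge> 0)}"

definition rp1_open_interval :: "rp1 set \<Rightarrow> bool" where
  "rp1_open_interval I \<longleftrightarrow> (\<exists>a b. a < b \<and> b - a < pi \<and>
      I = (\<lambda>\<theta>. rp1_of (vector [cos \<theta>, sin \<theta>])) ` {a<..<b})"

definition comps :: "'a::topological_space set \<Rightarrow> 'a set set" where
  "comps S = {connected_component_set S x | x. x \<in> S}"

definition row_stochastic :: "('x::finite \<Rightarrow> 'x \<Rightarrow> real) \<Rightarrow> bool" where
  "row_stochastic P \<longleftrightarrow> (\<forall>i j. P i j \<ge> 0) \<and> (\<forall>i. (\<Sum>j\<in>UNIV. P i j) = 1)"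

fun mpow :: "('x::finite \<Rightarrow> 'x \<Rightarrow> real) \<Rightarrow> nat \<Rightarrow> 'x \<Rightarrow> 'x \<Rightarrow> real" where
  "mpow P 0 i j = (if i = j then 1 else 0)"
| "mpow P (Suc n) i j = (\<Sum>k\<in>UNIV. mpow P n i k * P k j)"

definition irreducible_mat :: "('x::finite \<Rightarrow> 'x \<Rightarrow> real) \<Rightarrow> bool" where
  "irreducible_mat P \<longleftrightarrow> (\<forall>i j. \<exists>n\<ge>1. mpow P n i j > 0)"

definition stationary_vec :: "('x::finite \<Rightarrow> 'x \<Rightarrow> real) \<Rightarrow> ('x \<Rightarrow> real) \<Rightarrow> bool" where
  "stationary_vec P p \<longleftrightarrow> (\<forall>i. p i \<ge> 0) \<and> (\<Sum>i\<in>UNIV. p i) = 1 \<and>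
      (\<forall>j. (\<Sum>i\<in>UNIV. p i * P i j) = p j)"

definition markov_measure ::
    "('x::finite \<Rightarrow> 'x \<Rightarrow> real) \<Rightarrow> ('x \<Rightarrow> real) \<Rightarrow> 'x stream measure \<Rightarrow> bool" where
  "markov_measure P p \<mu> \<longleftrightarrow> prob_space \<mu> \<and>
     sets \<mu> = sets (stream_space (count_space UNIV)) \<and>
     (\<forall>w. w \<noteq> [] \<longrightarrow>
        measure \<mu> {\<omega> \<in> space \<mu>. stake (length w) \<omega> = w}
          = p (hd w) * (\<Prod>k<length w - 1. P (w ! k) (w ! Suc k)))"

definition cocycle :: "('x \<Rightarrow> real^2^2) \<Rightarrow> (nat \<Rightarrow> 'x) \<Rightarrow> nat \<Rightarrow> real^2^2" where
  "cocycle A x n = fold (\<lambda>k M. A (x k) ** M) [0..<n] (mat 1)"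

definition sigma_hat :: "('x \<Rightarrow> 'x \<Rightarrow> real) \<Rightarrow> (int \<Rightarrow> 'x) set" where
  "sigma_hat P = {x. \<forall>n. P (x n) (x (n + 1)) > 0}"

definition shift_hat :: "(int \<Rightarrow> 'x) \<Rightarrow> (int \<Rightarrow> 'x)" where
  "shift_hat x = (\<lambda>n. x (n + 1))"

text \<open>Continuity on sigma_hat with the product topology (X discrete): cylinders
  {y. y k = x k for |k| <= N} form a neighbourhood base.\<close>
definition cont_on_sigma_hat :: "('x \<Rightarrow> 'x \<Rightarrow> real) \<Rightarrow> ((int \<Rightarrow> 'x) \<Rightarrow> rp1) \<Rightarrow> bool" where
  "cont_on_sigma_hat P E \<longleftrightarrow> (\<forall>x\<in>sigma_hat P. \<forall>U. open U \<and> E x \<in> U \<longrightarrow>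
      (\<exists>N::nat. \<forall>y\<in>sigma_hat P. (\<forall>k. \<bar>k\<bar> \<le> int N \<longrightarrow> y k = x k) \<longrightarrow> E y \<in> U))"

definition proj_unif_hyp :: "('x \<Rightarrow> 'x \<Rightarrow> real) \<Rightarrow> ('x \<Rightarrow> real^2^2) \<Rightarrow> bool" where
  "proj_unif_hyp P A \<longleftrightarrow> (\<exists>Ed Ew :: (int \<Rightarrow> 'x) \<Rightarrow> rp1.
      cont_on_sigma_hat P Ed \<and> cont_on_sigma_hat P Ew \<and>
      (\<forall>x\<in>sigma_hat P. Rep_rp1 (Ed x) \<inter> Rep_rp1 (Ew x) = {0}) \<and>
      (\<forall>x\<in>sigma_hat P. proj_act (A (x 0)) (Ed x) = Ed (shift_hat x) \<and>
                         proj_act (A (x 0)) (Ew x) = Ew (shift_hat x)) \<and>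
      (\<exists>n\<ge>1. \<forall>x\<in>sigma_hat P. \<forall>v w.
          v \<in> Rep_rp1 (Ew x) \<and> norm v = 1 \<and> w \<in> Rep_rp1 (Ed x) \<and> norm w = 1 \<longrightarrow>
          norm (cocycle A (\<lambda>k. x (int k)) n *v v) < norm (cocycle A (\<lambda>k. x (int k)) n *v w)))"

definition multicone :: "('x \<Rightarrow> 'x \<Rightarrow> real) \<Rightarrow> ('x \<Rightarrow> real^2^2) \<Rightarrow> ('x \<Rightarrow> rp1 set) \<Rightarrow> bool" where
  "multicone P A M \<longleftrightarrow>
     (\<forall>i. M i \<noteq> {} \<and> M i \<noteq> UNIV \<and>
          (\<exists>F. finite F \<and> (\<forall>I\<in>F. rp1_open_interval I) \<and> M i = \<Union>F)) \<and>
     (\<forall>i j. P i j > 0 \<longrightarrow> closure (proj_act (A j) ` M i) \<subseteq> M j)"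

text \<open>Branch states are pairs (i, K) with K a connected component of M_i.\<close>
definition beta_br :: "('x \<Rightarrow> real^2^2) \<Rightarrow> ('x \<Rightarrow> rp1 set) \<Rightarrow> 'x \<Rightarrow> rp1 set \<Rightarrow> 'x \<Rightarrow> rp1 set" where
  "beta_br A M i K j = (THE K'. K' \<in> comps (M j) \<and> proj_act (A j) ` closure K \<subseteq> K')"

type_synonym 'x bstate = "'x \<times> rp1 set"
type_synonym 'x rstate = "'x bstate \<times> 'x bstate"

definition Rset :: "('x \<Rightarrow> 'x \<Rightarrow> real) \<Rightarrow> ('x \<Rightarrow> real^2^2) \<Rightarrow> ('x \<Rightarrow> rp1 set) \<Rightarrow> 'x rstate set" where
  "Rset P A M = {((i, K), (j, K')). P i j > 0 \<and> K \<in> comps (M i) \<and> K' = beta_br A M i K j}"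

definition Qmat :: "('x \<Rightarrow> 'x \<Rightarrow> real) \<Rightarrow> 'x rstate \<Rightarrow> 'x rstate \<Rightarrow> real" where
  "Qmat P r r' = (if snd r = fst r' then P (fst (snd r)) (fst (snd r')) else 0)"

fun rpow :: "'r set \<Rightarrow> ('r \<Rightarrow> 'r \<Rightarrow> real) \<Rightarrow> nat \<Rightarrow> 'r \<Rightarrow> 'r \<Rightarrow> real" where
  "rpow C Q 0 r r' = (if r = r' then 1 else 0)"
| "rpow C Q (Suc n) r r' = (\<Sum>c\<in>C. rpow C Q n r c * Q c r')"

definition recurrent_class ::
    "('x \<Rightarrow> 'x \<Rightarrow> real) \<Rightarrow> ('x \<Rightarrow> real^2^2) \<Rightarrow> ('x \<Rightarrow> rp1 set) \<Rightarrow> 'x rstate set \<Rightarrow> bool" where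
  "recurrent_class P A M C \<longleftrightarrow> C \<noteq> {} \<and> C \<subseteq> Rset P A M \<and>
     (\<forall>r\<in>C. \<forall>r'\<in>C. \<exists>n\<ge>1. rpow C (Qmat P) n r r' > 0) \<and>
     (\<forall>r\<in>C. \<forall>r'\<in>Rset P A M. Qmat P r r' > 0 \<longrightarrow> r' \<in> C)"

definition local_charts :: "('x \<Rightarrow> rp1 set) \<Rightarrow> ('x bstate \<Rightarrow> real^2^2) \<Rightarrow> bool" where
  "local_charts M L \<longleftrightarrow> (\<forall>i. \<forall>K\<in>comps (M i).
      invertible (L (i, K)) \<and> proj_act (L (i, K)) ` Vnonneg = closure K)"

text \<open>B_r = eps(r) L_{t(r)}^{-1} A_{tau(r)} L_{s(r)}, sign chosen to make all entries positive.\<close>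
definition Bloc :: "('x \<Rightarrow> real^2^2) \<Rightarrow> ('x bstate \<Rightarrow> real^2^2) \<Rightarrow> 'x rstate \<Rightarrow> real^2^2" where
  "Bloc A L r = (let G = matrix_inv (L (snd r)) ** A (fst (snd r)) ** L (fst r)
                 in if (\<forall>i j. G $ i $ j > 0) then G else - G)"

definition period :: "'r set \<Rightarrow> ('r \<Rightarrow> 'r \<Rightarrow> real) \<Rightarrow> 'r \<Rightarrow> nat" where
  "period C Q r = Gcd {n. n \<ge> 1 \<and> rpow C Q n r r > 0}"

definition cyc_class :: "'r set \<Rightarrow> ('r \<Rightarrow> 'r \<Rightarrow> real) \<Rightarrow> 'r \<Rightarrow> nat \<Rightarrow> 'r set" where
  "cyc_class C Q rs u = {r\<in>C. \<exists>n. n mod period C Q rs = u \<and> rpow C Q n rs r > 0}"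

text \<open>Reduced states: tuples (c_0,...,c_{d-1}) as lists of length d
  (for d = 1 this is just C, up to the bijection r <-> [r]).\<close>
definition redC :: "'r set \<Rightarrow> ('r \<Rightarrow> 'r \<Rightarrow> real) \<Rightarrow> 'r \<Rightarrow> 'r list set" where
  "redC C Q rs = (let d = period C Q rs in
     {c. length c = d \<and> (\<forall>u<d. c ! u \<in> cyc_class C Q rs u) \<and>
         (\<forall>u. Suc u < d \<longrightarrow> Q (c ! u) (c ! Suc u) > 0)})"

definition redQ :: "('r \<Rightarrow> 'r \<Rightarrow> real) \<Rightarrow> 'r list \<Rightarrow> 'r list \<Rightarrow> real" where
  "redQ Q c c' = Q (last c) (hd c') * (\<Prod>u<length c' - 1. Q (c' ! u) (c' ! Suc u))"

definition redB :: "('r \<Rightarrow> real^2^2) \<Rightarrow> 'r list \<Rightarrow> real^2^2" where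
  "redB B c = fold (\<lambda>r G. B r ** G) c (mat 1)"

definition stationary_on :: "'r set \<Rightarrow> ('r \<Rightarrow> 'r \<Rightarrow> real) \<Rightarrow> ('r \<Rightarrow> real) \<Rightarrow> bool" where
  "stationary_on C Q \<pi> \<longleftrightarrow> (\<forall>r\<in>C. \<pi> r \<ge> 0) \<and> (\<Sum>r\<in>C. \<pi> r) = 1 \<and>
      (\<forall>r'\<in>C. (\<Sum>r\<in>C. \<pi> r * Q r r') = \<pi> r')"

definition mob_alpha :: "real^2^2 \<Rightarrow> real" where
  "mob_alpha B = (B$1$1 - B$1$2 - B$2$1 + B$2$2) / 2"
definition mob_beta :: "real^2^2 \<Rightarrow> real" where
  "mob_beta B = (B$1$1 + B$1$2 - B$2$1 - B$2$2) / 2"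
definition mob_gamma :: "real^2^2 \<Rightarrow> real" where
  "mob_gamma B = (B$1$1 - B$1$2 + B$2$1 - B$2$2) / 2"
definition mob_delta :: "real^2^2 \<Rightarrow> real" where
  "mob_delta B = (B$1$1 + B$1$2 + B$2$1 + B$2$2) / 2"

definition mob_f :: "real^2^2 \<Rightarrow> real \<Rightarrow> real" where
  "mob_f B x = (mob_alpha B * x + mob_beta B) / (mob_gamma B * x + mob_delta B)"
definition mob_fT :: "real^2^2 \<Rightarrow> real \<Rightarrow> real" where
  "mob_fT B x = (mob_alpha B * x + mob_gamma B) / (mob_beta B * x + mob_delta B)"
definition mob_ell :: "real^2^2 \<Rightarrow> complex \<Rightarrow> complex" where
  "mob_ell B x = Ln (of_real (mob_gamma B) * x + of_real (mob_delta B))"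

definition bcoef :: "real^2^2 \<Rightarrow> nat \<Rightarrow> nat \<Rightarrow> complex" where
  "bcoef B k n =
     (if n = 0 then 0
      else if k = 0 then of_real (mob_fT B 0) ^ n
      else (\<Sum>l=1..min k n. of_nat (n choose l) * of_nat ((k - 1) choose (l - 1)) *
              of_real (mob_fT B 0) ^ (n - l) * of_real (- mob_f B 0) ^ (k - l) *
              of_real (deriv (mob_f B) 0) ^ l))"

definition Top1 :: "real^2^2 \<Rightarrow> (nat \<Rightarrow> complex) \<Rightarrow> (nat \<Rightarrow> complex)" where
  "Top1 B u = (\<lambda>k. \<Sum>n. bcoef B k n * u n)"

definition vseq :: "complex \<Rightarrow> complex \<Rightarrow> nat \<Rightarrow> complex" where
  "vseq x c n = (if n = 0 then c else - ((- x) ^ n) / of_nat n)"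

definition Top :: "'r set \<Rightarrow> ('r \<Rightarrow> 'r \<Rightarrow> real) \<Rightarrow> ('r \<Rightarrow> real) \<Rightarrow> ('r \<Rightarrow> real^2^2)
      \<Rightarrow> ('r \<Rightarrow> nat \<Rightarrow> complex) \<Rightarrow> ('r \<Rightarrow> nat \<Rightarrow> complex)" where
  "Top C Q \<pi> B U = (\<lambda>r' k. \<Sum>r\<in>C. of_real (\<pi> r * Q r r' / \<pi> r') * Top1 (B r) (U r) k)"

definition seed :: "'r set \<Rightarrow> ('r \<Rightarrow> 'r \<Rightarrow> real) \<Rightarrow> ('r \<Rightarrow> real) \<Rightarrow> ('r \<Rightarrow> real^2^2)
      \<Rightarrow> ('r \<Rightarrow> nat \<Rightarrow> complex)" where
  "seed C Q \<pi> B = (\<lambda>s k. \<Sum>r\<in>C. of_real (\<pi> r * Q r s / \<pi> s) *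
       vseq (of_real (mob_f (B r) 0)) (mob_ell (B r) 0) k)"

definition coord0 :: "'r set \<Rightarrow> ('r \<Rightarrow> real) \<Rightarrow> ('r \<Rightarrow> nat \<Rightarrow> complex) \<Rightarrow> complex" where
  "coord0 C \<pi> W = (\<Sum>r\<in>C. of_real (\<pi> r) * W r 0)"

end

theory Submission
  imports Defs
begin

text \<open>
  The vectors \<open>v(x; c)\<close> are arranged so that \<open>T\<^sub>r v(x; c) = v(f\<^sub>r x; \<ell>\<^sub>r x) - v(f\<^sub>r 0; \<ell>\<^sub>r 0)\<close>.
  Hence the partial sums of the series telescope: the sum of the terms with \<open>n < N\<close> is \<open>1/d\<close> times
  the stationary mean of \<open>\<ell>\<close> at the \<open>N\<close>-th point of the orbit of \<open>0\<close>, which is the increment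
  \<open>g (N) - g (N - 1)\<close> of \<open>g (n) = E log (sum of the entries of B\<^sub>n \<cdots> B\<^sub>1)\<close>.
  By stationarity, two consecutive increments differ only by the choice of the initial positive
  vector, and products of positive matrices forget it geometrically fast; so the increments
  converge, and their limit is that of \<open>g (n) / n\<close>. Up to bounded error \<open>g (n)\<close> is the mean of
  \<open>log \<parallel>A\<^sup>n\<^sup>d\<parallel>\<close>, because every transition of the base chain lifts to exactly one transition of the
  recurrent class and the charts cancel along paths. Dominated convergence applied to the almost
  sure limit on the cylinder of each initial symbol gives \<open>g (n) / n \<longlonglongrightarrow> d \<lambda>\<close>.
\<close>

section \<open>The action of a single operator\<close>

text \<open>The four Moebius coefficients are the entries of \<open>B\<close> in the coordinates
  \<open>(v $ 1 - v $ 2, v $ 1 + v $ 2)\<close>. The quotient of these two coordinates carries the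
  open positive cone onto \<open>(-1, 1)\<close> and the vector \<open>(1, 1)\<close> to
  \<open>0\<close>, and the denominator of \<open>f\<close> is the factor by which the coordinate
  sum grows; this is why a series built from the orbit of \<open>0\<close> sees a growth rate. A
  limit of \<open>g (n) / n\<close> alone would not make the series converge: it concerns only
  Cesaro means of the partial sums, and the contraction of positive matrices supplies the actual
  limit. Means over the recurrent class and over the reduced chain are iterates of a transition
  operator, so that no measure on their path spaces has to be built; the only integrals are over
  \<open>\<mu>\<close>. The comparison with \<open>\<mu>\<close> is made from one initial state at a
  time, so that averaging over \<open>\<pi>\<close> does not change the rate.\<close>

definition pos_mat :: "real^2^2 \<Rightarrow> bool" where
  "pos_mat B \<longleftrightarrow> (\<forall>i j. B $ i $ j > 0)"

lemma pos_matD: "pos_mat B \<Longrightarrow> B $ i $ j > 0"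
  by (simp add: pos_mat_def)

definition rvseq :: "real \<times> real \<Rightarrow> nat \<Rightarrow> real" where
  "rvseq y n = (if n = 0 then snd y else - ((- fst y) ^ n) / real n)"

text \<open>The map of pairs \<open>(x, c)\<close> that \<open>T_r\<close> induces on the vectors
  \<open>v(x; c)\<close>, up to a constant vector. It forgets \<open>c\<close>, in accordance with
  the vanishing column \<open>n = 0\<close> of \<open>bcoef\<close>; along an orbit the second entry
  is therefore the logarithm of the last denominator only.\<close>

definition mob_step :: "real^2^2 \<Rightarrow> real \<times> real \<Rightarrow> real \<times> real" where
  "mob_step B y = (mob_f B (fst y), ln (mob_gamma B * fst y + mob_delta B))"

lemma vseq_of_real: "vseq (of_real x) (of_real c) n = of_real (rvseq (x, c) n)"
  by (simp add: vseq_def rvseq_def)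

lemma pos_mat_mob_bounds:
  assumes "pos_mat B"
  shows "0 < mob_delta B" "\<bar>mob_gamma B\<bar> < mob_delta B" "\<bar>mob_fT B 0\<bar> < 1"
proof -
  note p = pos_matD[OF assms, of 1 1] pos_matD[OF assms, of 1 2]
           pos_matD[OF assms, of 2 1] pos_matD[OF assms, of 2 2]
  show a: "0 < mob_delta B" "\<bar>mob_gamma B\<bar> < mob_delta B"
    unfolding mob_delta_def mob_gamma_def using p by auto
  then show "\<bar>mob_fT B 0\<bar> < 1" by (simp add: mob_fT_def)
qed

lemma mob_denominator_pos:
  assumes "pos_mat B" "\<bar>x\<bar> \<le> 1"
  shows "0 < mob_gamma B * x + mob_delta B"
proof -
  have "\<bar>mob_gamma B * x\<bar> \<le> \<bar>mob_gamma B\<bar> * 1"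
    unfolding abs_mult by (intro mult_left_mono assms) auto
  then show ?thesis using pos_mat_mob_bounds(2)[OF assms(1)] by linarith
qed

lemma abs_mob_f_le_1:
  assumes "pos_mat B" "\<bar>x\<bar> \<le> 1"
  shows "\<bar>mob_f B x\<bar> \<le> 1"
proof -
  note p = pos_matD[OF assms(1), of 1 1] pos_matD[OF assms(1), of 1 2]
           pos_matD[OF assms(1), of 2 1] pos_matD[OF assms(1), of 2 2]
  have d: "0 < mob_gamma B * x + mob_delta B" using mob_denominator_pos[OF assms] .
  have x: "0 \<le> 1 + x" "0 \<le> 1 - x" using assms(2) by auto
  have "0 \<le> B$1$1 * (1 + x)" "0 \<le> B$1$2 * (1 - x)" "0 \<le> B$2$1 * (1 + x)" "0 \<le> B$2$2 * (1 - x)"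
    using p x by (auto intro: mult_nonneg_nonneg less_imp_le)
  then have "\<bar>mob_alpha B * x + mob_beta B\<bar> \<le> mob_gamma B * x + mob_delta B"
    unfolding mob_alpha_def mob_beta_def mob_gamma_def mob_delta_def abs_le_iff
    by (simp add: field_simps)
  then show ?thesis unfolding mob_f_def abs_divide using d by (simp add: divide_le_eq)
qed

text \<open>Expansion of a Moebius map about \<open>0\<close>. It separates the dependence on
  \<open>x\<close>, which sits in \<open>x / (1 + f^T(0) x)\<close>, from the affine map given by
  \<open>f(0)\<close> and \<open>f'(0)\<close>; the sums over \<open>n\<close> and over
  \<open>l\<close> in the matrix entries reproduce these two parts one after the other.\<close>

lemma mob_f_split:
  assumes "pos_mat B" "\<bar>x\<bar> \<le> 1"
  shows "mob_f B x = mob_f B 0 + deriv (mob_f B) 0 * (x / (1 + mob_fT B 0 * x))"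
proof -
  have d: "0 < mob_delta B" using pos_mat_mob_bounds[OF assms(1)] by simp
  have e: "0 < mob_gamma B * x + mob_delta B" using mob_denominator_pos[OF assms] .
  have "(mob_f B has_field_derivative
      (mob_alpha B * mob_delta B - mob_beta B * mob_gamma B) / (mob_delta B)\<^sup>2) (at 0)"
    unfolding mob_f_def using d by (auto intro!: derivative_eq_intros simp: power2_eq_square field_simps)
  then have D: "deriv (mob_f B) 0 = (mob_alpha B * mob_delta B - mob_beta B * mob_gamma B) / (mob_delta B)\<^sup>2"
    by (rule DERIV_imp_deriv)
  have "1 + mob_fT B 0 * x = (mob_gamma B * x + mob_delta B) / mob_delta B"
    using d by (simp add: mob_fT_def field_simps)
  then have q: "x / (1 + mob_fT B 0 * x) = x * mob_delta B / (mob_gamma B * x + mob_delta B)" by simp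
  show ?thesis unfolding q D unfolding mob_f_def using d e
    by (simp add: divide_simps power2_eq_square) algebra
qed

lemma negative_binomial_sums:
  fixes z :: real
  assumes "\<bar>z\<bar> < 1"
  shows "(\<lambda>m. real ((m + j) choose j) * z ^ m) sums (1 / (1 - z) ^ Suc j)"
proof -
  have "(\<lambda>m. ((- real (Suc j)) gchoose m) * (- z) ^ m) sums (1 + - z) powr (- real (Suc j))"
    by (rule gen_binomial_real) (use assms in auto)
  moreover have "((- real (Suc j)) gchoose m) * (- z) ^ m = real ((m + j) choose j) * z ^ m" for m
  proof -
    have "((- real (Suc j)) gchoose m) = (-1)^m * ((real (Suc j) + real m - 1) gchoose m)"
      by (rule gbinomial_minus)
    also have "real (Suc j) + real m - 1 = real (m + j)" by simp
    also have "real (m + j) gchoose m = real ((m + j) choose j)"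
      by (metis binomial_gbinomial binomial_symmetric diff_add_inverse le_add1)
    finally have "(- real (Suc j) gchoose m) * (- z) ^ m = real ((m + j) choose j) * ((-1) ^ m * (- z) ^ m)"
      by (simp only: mult_ac)
    also have "(-1) ^ m * (- z) ^ m = z ^ m" by (subst power_mult_distrib[symmetric]) simp
    finally show ?thesis .
  qed
  moreover have "(1 + - z) powr (- real (Suc j)) = 1 / (1 - z) ^ Suc j"
    using assms by (subst powr_minus, subst powr_realpow) (auto simp: field_simps)
  ultimately show ?thesis by simp
qed

text \<open>By the absorption identity \<open>l * (n choose l) = n * ((n-1) choose (l-1))\<close>
  the factor \<open>1 / n\<close> turns into \<open>1 / l\<close>, and what remains is the negative
  binomial series at \<open>- t * x\<close>.\<close>

lemma shifted_binomial_sums: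
  fixes t x :: real
  assumes "\<bar>t * x\<bar> < 1" "1 \<le> l"
  shows "(\<lambda>n. real (n choose l) * t ^ (n - l) * (- ((- x) ^ n) / real n))
           sums (- ((- (x / (1 + t * x))) ^ l / real l))"
proof -
  let ?f = "\<lambda>n. real (n choose l) * t ^ (n - l) * (- ((- x) ^ n) / real n)"
  have "(\<lambda>m. real ((m + (l-1)) choose (l-1)) * (- (t * x)) ^ m) sums (1 / (1 - - (t * x)) ^ Suc (l-1))"
    by (rule negative_binomial_sums) (use assms in auto)
  from sums_mult[OF this, of "- ((- x) ^ l / real l)"]
  have "(\<lambda>m. - ((- x) ^ l / real l) * (real ((m + (l-1)) choose (l-1)) * (- (t * x)) ^ m))
      sums (- ((- x) ^ l / real l) * (1 / (1 + t * x) ^ l))"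
    using assms(2) by simp
  also have "(\<lambda>m. - ((- x) ^ l / real l) * (real ((m + (l-1)) choose (l-1)) * (- (t * x)) ^ m)) = (\<lambda>m. ?f (m + l))"
  proof
    fix m
    have "l * ((m + l) choose l) = (m + l) * ((m + (l-1)) choose (l-1))"
      using binomial_absorption[of "l - 1" "m + l"] assms(2) by (cases l) simp_all
    then have "real l * real ((m + l) choose l) = real (m + l) * real ((m + (l-1)) choose (l-1))"
      by (metis of_nat_mult)
    then have e: "real ((m + l) choose l) / real (m + l) = real ((m + (l-1)) choose (l-1)) / real l"
      using assms(2) by (simp add: field_simps)
    have "?f (m + l) = - (real ((m + l) choose l) / real (m + l)) * (t ^ m * (- x) ^ m * (- x) ^ l)"
      by (simp add: power_add)
    also have "\<dots> = - ((- x) ^ l / real l) * (real ((m + (l-1)) choose (l-1)) * (- (t * x)) ^ m)"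
      unfolding e power_mult_distrib[symmetric] by simp
    finally show "- ((- x) ^ l / real l) * (real ((m + (l-1)) choose (l-1)) * (- (t * x)) ^ m) = ?f (m + l)" ..
  qed
  also have "- ((- x) ^ l / real l) * (1 / (1 + t * x) ^ l) = - ((- (x / (1 + t * x))) ^ l / real l)"
    by (simp only: minus_divide_left power_divide) simp
  finally have "(\<lambda>m. ?f (m + l)) sums (- ((- (x / (1 + t * x))) ^ l / real l))" .
  moreover have "(\<Sum>n<l. ?f n) = 0" by (intro sum.neutral) (auto simp: binomial_eq_0)
  ultimately show ?thesis by (subst (asm) sums_iff_shift) simp
qed

text \<open>The same absorption identity turns the sum into the binomial expansion of
  \<open>(a + y) ^ k\<close> without its term \<open>l = 0\<close>; that missing term is the
  subtracted \<open>a ^ k\<close>.\<close>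

lemma binomial_difference_sum:
  fixes a y :: real
  assumes "1 \<le> k"
  shows "(\<Sum>l=1..k. real ((k - 1) choose (l - 1)) * a ^ (k - l) * (y ^ l / real l))
           = ((a + y) ^ k - a ^ k) / real k"
proof -
  have "(y + a) ^ k = (\<Sum>l\<le>k. of_nat (k choose l) * y ^ l * a ^ (k - l))"
    by (rule binomial_ring)
  also have "{..k} = insert 0 {1..k}" by auto
  finally have "(a + y) ^ k - a ^ k = (\<Sum>l=1..k. real (k choose l) * y ^ l * a ^ (k - l))"
    by (simp add: add.commute)
  moreover have "real ((k - 1) choose (l - 1)) * a ^ (k - l) * (y ^ l / real l)
      = real (k choose l) * y ^ l * a ^ (k - l) / real k" if "l \<in> {1..k}" for l
  proof -
    have "l * (k choose l) = k * ((k - 1) choose (l - 1))"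
      using binomial_absorption[of "l - 1" "k"] that by (cases l) simp_all
    then have "real l * real (k choose l) = real k * real ((k - 1) choose (l - 1))"
      by (metis of_nat_mult)
    then have "real ((k - 1) choose (l - 1)) / real l = real (k choose l) / real k"
      using that by (simp add: field_simps)
    then show ?thesis by (metis (no_types, opaque_lifting) times_divide_eq_left times_divide_eq_right mult.commute mult.left_commute)
  qed
  ultimately show ?thesis by (simp add: sum_divide_distrib)
qed

text \<open>Row \<open>0\<close> is the series of \<open>ln (1 + t * x)\<close>, and
  \<open>1 + t * x\<close> is the quotient of the denominators at \<open>x\<close> and at
  \<open>0\<close>. In the rows \<open>k \<ge> 1\<close> the sum over \<open>n\<close> is taken
  first for each \<open>l\<close>, and the sum over \<open>l\<close> then gives powers of
  \<open>f(x)\<close> and \<open>f(0)\<close>. All series converge even for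
  \<open>\<bar>x\<bar> = 1\<close>, because \<open>\<bar>t\<bar> < 1\<close>.\<close>

lemma Top1_rvseq_sums:
  assumes B: "pos_mat B" and y: "\<bar>fst y\<bar> \<le> 1"
  shows "(\<lambda>n. bcoef B k n * of_real (rvseq y n))
            sums of_real (rvseq (mob_step B y) k - rvseq (mob_step B (0, 0)) k)"
proof -
  define t where "t = mob_fT B 0"
  define x where "x = fst y"
  have t: "\<bar>t\<bar> < 1" using pos_mat_mob_bounds[OF B] t_def by simp
  have "\<bar>t\<bar> * \<bar>x\<bar> \<le> \<bar>t\<bar> * 1" using y by (intro mult_left_mono) (auto simp: x_def)
  then have tx: "\<bar>t * x\<bar> < 1" using t by (simp add: abs_mult)
  show ?thesis
  proof (cases "k = 0")
    case True
    have e: "bcoef B k n * of_real (rvseq y n) = of_real (- ((- (t * x)) ^ n) / real n)" for n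
    proof (cases "n = 0")
      case False
      have "(- (t * x)) ^ n = t ^ n * (- x) ^ n" by (simp flip: power_mult_distrib)
      then show ?thesis using True False by (simp add: bcoef_def rvseq_def t_def x_def)
    qed (simp add: bcoef_def)
    have "(\<lambda>n. - ((- (t * x)) ^ n) / real n) sums ln (1 + t * x)" by (rule ln_series'[OF tx])
    moreover have "ln (1 + t * x) = rvseq (mob_step B y) k - rvseq (mob_step B (0, 0)) k"
    proof -
      have "0 < mob_delta B" "0 < mob_gamma B * x + mob_delta B"
        using pos_mat_mob_bounds[OF B] mob_denominator_pos[OF B y] by (auto simp: x_def)
      moreover from this have "1 + t * x = (mob_gamma B * x + mob_delta B) / mob_delta B"
        by (simp add: t_def mob_fT_def field_simps)
      ultimately show ?thesis using True
        by (simp add: rvseq_def mob_step_def x_def ln_div)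
    qed
    ultimately show ?thesis unfolding e by (simp only: sums_of_real_iff)
  next
    case False
    define a where "a = - mob_f B 0"
    define D where "D = deriv (mob_f B) 0"
    define w where "w = - (x / (1 + t * x))"
    let ?c = "\<lambda>l. real ((k - 1) choose (l - 1)) * a ^ (k - l) * D ^ l"
    let ?h = "\<lambda>l n. real (n choose l) * t ^ (n - l) * (- ((- x) ^ n) / real n)"
    have e: "bcoef B k n * of_real (rvseq y n) = of_real (\<Sum>l=1..k. ?c l * ?h l n)" for n
    proof (cases "n = 0")
      case True
      then show ?thesis by (simp add: bcoef_def)
    next
      case n: False
      \<comment> \<open>The terms with \<open>l > n\<close> vanish with \<open>n choose l\<close>.
        So the range of \<open>l\<close> can be made independent of \<open>n\<close>, and the
        interchange with the series over \<open>n\<close> concerns a finite sum.\<close>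
      have "(\<Sum>l=1..k. ?c l * ?h l n) = (\<Sum>l=1..min k n. ?c l * ?h l n)"
        by (rule sum.mono_neutral_right) auto
      then show ?thesis
        using False n unfolding bcoef_def rvseq_def t_def x_def a_def D_def
        by (simp add: sum_distrib_left sum_distrib_right sum_divide_distrib sum_negf mult_ac)
    qed
    have "(\<lambda>n. \<Sum>l=1..k. ?c l * ?h l n) sums (\<Sum>l=1..k. ?c l * (- (w ^ l / real l)))"
      unfolding w_def by (intro sums_sum sums_mult shifted_binomial_sums tx) auto
    also have "(\<Sum>l=1..k. ?c l * (- (w ^ l / real l)))
       = - (\<Sum>l=1..k. real ((k - 1) choose (l - 1)) * a ^ (k - l) * ((D * w) ^ l / real l))"
      unfolding sum_negf[symmetric] by (intro sum.cong) (auto simp: power_mult_distrib)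
    also have "\<dots> = - (((a + D * w) ^ k - a ^ k) / real k)"
      using False by (subst binomial_difference_sum) auto
    also have "a + D * w = - mob_f B x"
      using mob_f_split[OF B y] by (simp add: a_def D_def w_def t_def x_def)
    also have "- (((- mob_f B x) ^ k - a ^ k) / real k) = rvseq (mob_step B y) k - rvseq (mob_step B (0, 0)) k"
      using False by (simp add: rvseq_def mob_step_def x_def a_def diff_divide_distrib)
    finally show ?thesis unfolding e by (simp only: sums_of_real_iff)
  qed
qed

section \<open>Telescoping\<close>

text \<open>The mean of \<open>h\<close> over the time-reversed chain started at \<open>s\<close>. The guard in the first equation
  makes it consistent with the junk value \<open>x / 0 = 0\<close> in the second one when \<open>\<pi> s = 0\<close>.\<close>

fun backward_mean ::
  "'r set \<Rightarrow> ('r \<Rightarrow> 'r \<Rightarrow> real) \<Rightarrow> ('r \<Rightarrow> real) \<Rightarrow> ('r \<Rightarrow> 'y \<Rightarrow> 'y) \<Rightarrow> 'y \<Rightarrow> nat \<Rightarrow> 'r \<Rightarrow> ('y \<Rightarrow> real) \<Rightarrow> real"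
where
  "backward_mean C Q \<pi> F y0 0 s h = (if \<pi> s = 0 then 0 else h y0)"
| "backward_mean C Q \<pi> F y0 (Suc n) s h =
     (\<Sum>r\<in>C. \<pi> r * Q r s / \<pi> s * backward_mean C Q \<pi> F y0 n r (\<lambda>y. h (F r y)))"

definition chain_op ::
  "'r set \<Rightarrow> ('r \<Rightarrow> 'r \<Rightarrow> real) \<Rightarrow> ('r \<Rightarrow> 'y \<Rightarrow> 'y) \<Rightarrow> ('r \<Rightarrow> 'y \<Rightarrow> real) \<Rightarrow> 'r \<Rightarrow> 'y \<Rightarrow> real" where
  "chain_op C Q F h r y = (\<Sum>s\<in>C. Q r s * h s (F r y))"

text \<open>A backward mean is a finite linear combination of values at orbit points of
  \<open>y0\<close>, so a series identity passes through it once it holds at all these points. The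
  invariant predicate \<open>D\<close> confines them to the domain of convergence.\<close>

lemma backward_mean_sums:
  fixes a :: "nat \<Rightarrow> complex"
  assumes "\<And>y. D y \<Longrightarrow> (\<lambda>m. a m * of_real (h m y)) sums of_real (H y)"
    and "D y0" and "\<And>r y. r \<in> C \<Longrightarrow> D y \<Longrightarrow> D (F r y)"
  shows "(\<lambda>m. a m * of_real (backward_mean C Q \<pi> F y0 n s (h m)))
           sums of_real (backward_mean C Q \<pi> F y0 n s H)"
  using assms(1)
proof (induction n arbitrary: s h H)
  case 0
  then show ?case using assms(2) by simp
next
  case (Suc n)
  let ?w = "\<lambda>r. of_real (\<pi> r * Q r s / \<pi> s) :: complex"
  have "(\<lambda>m. \<Sum>r\<in>C. ?w r * (a m * of_real (backward_mean C Q \<pi> F y0 n r (\<lambda>y. h m (F r y)))))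
      sums (\<Sum>r\<in>C. ?w r * of_real (backward_mean C Q \<pi> F y0 n r (\<lambda>y. H (F r y))))"
    by (intro sums_sum sums_mult Suc.IH Suc.prems assms(3))
  then show ?case by (simp add: sum_distrib_left mult_ac)
qed

lemma backward_mean_linear:
  "backward_mean C Q \<pi> F y0 n s (\<lambda>y. \<Sum>j\<in>J. c j * h j y) = (\<Sum>j\<in>J. c j * backward_mean C Q \<pi> F y0 n s (h j))"
proof (induction n arbitrary: s h)
  case (Suc n)
  show ?case
    unfolding backward_mean.simps Suc.IH sum_distrib_left
    by (subst sum.swap) (simp add: mult_ac)
qed simp

text \<open>Time reversal: the factor \<open>\<pi> s\<close> cancels the denominator of the reversed
  weight and leaves the forward weight \<open>\<pi> r * Q r s\<close>. If
  \<open>\<pi> s = 0\<close>, stationarity makes these nonnegative weights sum to \<open>0\<close>,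
  so each of them vanishes and the division by zero does no harm.\<close>

lemma backward_forward_duality:
  assumes fin: "finite C" and nonneg: "\<And>r s. r \<in> C \<Longrightarrow> s \<in> C \<Longrightarrow> 0 \<le> Q r s" and \<pi>: "stationary_on C Q \<pi>"
  shows "(\<Sum>s\<in>C. \<pi> s * backward_mean C Q \<pi> F y0 n s (h s))
           = (\<Sum>r\<in>C. \<pi> r * (chain_op C Q F ^^ n) h r y0)"
proof (induction n arbitrary: h)
  case 0
  show ?case by (intro sum.cong) auto
next
  case (Suc n)
  have null: "\<pi> r * Q r s = 0" if "r \<in> C" "s \<in> C" "\<pi> s = 0" for r s
  proof -
    have "(\<Sum>r\<in>C. \<pi> r * Q r s) = 0" using \<pi> that by (simp add: stationary_on_def)
    moreover have "\<And>r. r \<in> C \<Longrightarrow> 0 \<le> \<pi> r * Q r s"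
      using \<pi> nonneg that by (simp add: stationary_on_def)
    ultimately show ?thesis using sum_nonneg_eq_0_iff[OF fin, of "\<lambda>r. \<pi> r * Q r s"] that by simp
  qed
  have "\<pi> s * backward_mean C Q \<pi> F y0 (Suc n) s (h s)
      = (\<Sum>r\<in>C. \<pi> r * (Q r s * backward_mean C Q \<pi> F y0 n r (\<lambda>y. h s (F r y))))" if "s \<in> C" for s
    unfolding backward_mean.simps sum_distrib_left using null[OF _ that] by (intro sum.cong) auto
  then have "(\<Sum>s\<in>C. \<pi> s * backward_mean C Q \<pi> F y0 (Suc n) s (h s))
      = (\<Sum>s\<in>C. \<Sum>r\<in>C. \<pi> r * (Q r s * backward_mean C Q \<pi> F y0 n r (\<lambda>y. h s (F r y))))"
    by (intro sum.cong) auto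
  also have "\<dots> = (\<Sum>r\<in>C. \<pi> r * backward_mean C Q \<pi> F y0 n r (chain_op C Q F h r))"
    unfolding chain_op_def backward_mean_linear sum_distrib_left by (rule sum.swap)
  also have "\<dots> = (\<Sum>r\<in>C. \<pi> r * (chain_op C Q F ^^ n) (chain_op C Q F h) r y0)"
    by (rule Suc.IH)
  finally show ?case by (simp add: funpow_swap1)
qed

lemma backward_mean_diff:
  "backward_mean C Q \<pi> F y0 n s (\<lambda>y. g y - h y) = backward_mean C Q \<pi> F y0 n s g - backward_mean C Q \<pi> F y0 n s h"
proof (induction n arbitrary: s g h)
  case (Suc n)
  show ?case unfolding backward_mean.simps Suc.IH by (simp add: right_diff_distrib sum_subtractf)
qed simp

lemma backward_mean_const:
  assumes \<pi>: "stationary_on C Q \<pi>" and "s \<in> C"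
  shows "backward_mean C Q \<pi> F y0 n s (\<lambda>y. c) = (if \<pi> s = 0 then 0 else c)"
  using assms(2)
proof (induction n arbitrary: s)
  case (Suc n)
  have "backward_mean C Q \<pi> F y0 (Suc n) s (\<lambda>y. c)
      = (\<Sum>r\<in>C. \<pi> r * Q r s / \<pi> s * (if \<pi> r = 0 then 0 else c))"
    unfolding backward_mean.simps by (intro sum.cong) (auto simp: Suc.IH)
  also have "\<dots> = (\<Sum>r\<in>C. \<pi> r * Q r s) * (c / \<pi> s)"
    unfolding sum_distrib_right by (intro sum.cong) auto
  also have "(\<Sum>r\<in>C. \<pi> r * Q r s) = \<pi> s" using \<pi> Suc.prems by (simp add: stationary_on_def)
  finally show ?case by simp
qed simp

text \<open>\<open>U n s\<close> is the mean of \<open>v\<close> at the \<open>n\<close>-th orbit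
  point, given the final state \<open>s\<close>. Applying \<open>Top\<close> to it yields
  \<open>U (Suc n) s\<close> minus a term from the base point \<open>(0, 0)\<close>. That term is
  the same for every \<open>n\<close>, so it cancels in differences of consecutive \<open>U\<close>,
  and \<open>Top\<close> acts on them as a shift of \<open>n\<close>.\<close>

lemma Top_iterate:
  fixes Q :: "'r \<Rightarrow> 'r \<Rightarrow> real" and \<pi> :: "'r \<Rightarrow> real"
  assumes pos: "\<And>r. r \<in> C \<Longrightarrow> pos_mat (B r)" and \<pi>: "stationary_on C Q \<pi>"
  defines "U \<equiv> \<lambda>n s k. backward_mean C Q \<pi> (\<lambda>r. mob_step (B r)) (0, 0) n s (\<lambda>y. rvseq y k)"
  shows "(Top C Q \<pi> B ^^ n) (\<lambda>s k. seed C Q \<pi> B s k / of_nat d)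
           = (\<lambda>s k. of_real ((U (Suc n) s k - U n s k) / real d))"
proof (induction n)
  case 0
  have "seed C Q \<pi> B s k = of_real (U (Suc 0) s k - U 0 s k)" for s k
  proof -
    have "mob_ell (B r) 0 = of_real (ln (mob_delta (B r)))" if "r \<in> C" for r
      using pos_mat_mob_bounds(1)[OF pos[OF that]] by (simp add: mob_ell_def Ln_of_real)
    then have "seed C Q \<pi> B s k = (\<Sum>r\<in>C. of_real (\<pi> r * Q r s / \<pi> s * rvseq (mob_step (B r) (0, 0)) k))"
      unfolding seed_def by (intro sum.cong) (auto simp: vseq_of_real mob_step_def)
    also have "\<dots> = of_real (U (Suc 0) s k)"
      unfolding U_def backward_mean.simps of_real_sum by (intro sum.cong) auto
    \<comment> \<open>Here \<open>U 0\<close> vanishes, because every entry of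
      \<open>v(0; 0)\<close> is zero; this lets the seed be read as a difference too.\<close>
    finally show ?thesis by (simp add: U_def rvseq_def)
  qed
  then show ?case by simp
next
  case (Suc n)
  let ?U' = "\<lambda>n r k. backward_mean C Q \<pi> (\<lambda>r. mob_step (B r)) (0, 0) n r (\<lambda>y. rvseq (mob_step (B r) y) k)"
  let ?c = "\<lambda>r k. if \<pi> r = 0 then 0 else rvseq (mob_step (B r) (0, 0)) k"
  have T: "(\<lambda>m. bcoef (B r) k m * of_real (U n r m)) sums of_real (?U' n r k - ?c r k)"
    if r: "r \<in> C" for r k n
  proof -
    have "(\<lambda>m. bcoef (B r) k m * of_real (U n r m)) sums
      of_real (backward_mean C Q \<pi> (\<lambda>r. mob_step (B r)) (0, 0) n r
        (\<lambda>y. rvseq (mob_step (B r) y) k - rvseq (mob_step (B r) (0, 0)) k))"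
      unfolding U_def
    proof (rule backward_mean_sums[where D = "\<lambda>y. \<bar>fst y\<bar> \<le> 1"])
      show "(\<lambda>m. bcoef (B r) k m * of_real (rvseq y m))
          sums of_real (rvseq (mob_step (B r) y) k - rvseq (mob_step (B r) (0, 0)) k)"
        if "\<bar>fst y\<bar> \<le> 1" for y
        by (rule Top1_rvseq_sums[OF pos[OF r] that])
      show "\<bar>fst (mob_step (B s) y)\<bar> \<le> 1" if "s \<in> C" "\<bar>fst y\<bar> \<le> 1" for s y
        using abs_mob_f_le_1[OF pos[OF that(1)] that(2)] by (simp add: mob_step_def)
    qed simp
    then show ?thesis unfolding backward_mean_diff backward_mean_const[OF \<pi> r] .
  qed
  have S: "Top1 (B r) (\<lambda>m. of_real ((U (Suc n) r m - U n r m) / real d)) k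
      = of_real ((?U' (Suc n) r k - ?U' n r k) / real d)" if "r \<in> C" for r k
  proof -
    have "(\<lambda>m. (bcoef (B r) k m * of_real (U (Suc n) r m) - bcoef (B r) k m * of_real (U n r m)) / of_nat d) sums
       ((of_real (?U' (Suc n) r k - ?c r k) - of_real (?U' n r k - ?c r k)) / of_nat d)"
      by (intro sums_divide sums_diff T that)
    then show ?thesis unfolding Top1_def
      by (intro sums_unique[symmetric]) (simp add: algebra_simps diff_divide_distrib)
  qed
  have "Top C Q \<pi> B (\<lambda>s k. of_real ((U (Suc n) s k - U n s k) / real d)) s k
      = of_real ((U (Suc (Suc n)) s k - U (Suc n) s k) / real d)" for s k
  proof -
    have "Top C Q \<pi> B (\<lambda>s k. of_real ((U (Suc n) s k - U n s k) / real d)) s k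
       = (\<Sum>r\<in>C. of_real (\<pi> r * Q r s / \<pi> s * ((?U' (Suc n) r k - ?U' n r k) / real d)))"
      unfolding Top_def by (intro sum.cong refl) (simp only: S of_real_mult)
    also have "\<dots> = of_real (((\<Sum>r\<in>C. \<pi> r * Q r s / \<pi> s * ?U' (Suc n) r k)
          - (\<Sum>r\<in>C. \<pi> r * Q r s / \<pi> s * ?U' n r k)) / real d)"
      by (simp only: of_real_sum[symmetric] sum_divide_distrib sum_subtractf[symmetric]
          right_diff_distrib diff_divide_distrib times_divide_eq_right)
    finally show ?thesis by (simp add: U_def)
  qed
  then show ?case unfolding funpow.simps o_apply Suc.IH by (intro ext)
qed

lemma coord0_partial_sums:
  assumes fin: "finite C" and nonneg: "\<And>r s. r \<in> C \<Longrightarrow> s \<in> C \<Longrightarrow> 0 \<le> Q r s"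
    and pos: "\<And>r. r \<in> C \<Longrightarrow> pos_mat (B r)" and \<pi>: "stationary_on C Q \<pi>"
  shows "(\<Sum>n<N. coord0 C \<pi> ((Top C Q \<pi> B ^^ n) (\<lambda>s k. seed C Q \<pi> B s k / of_nat d)))
    = of_real ((\<Sum>r\<in>C. \<pi> r * (chain_op C Q (\<lambda>r. mob_step (B r)) ^^ N) (\<lambda>r y. snd y) r (0, 0)) / real d)"
proof -
  define E where "E n = (\<Sum>r\<in>C. \<pi> r * (chain_op C Q (\<lambda>r. mob_step (B r)) ^^ n) (\<lambda>r y. snd y) r (0, 0))" for n
  have E: "E n = (\<Sum>s\<in>C. \<pi> s * backward_mean C Q \<pi> (\<lambda>r. mob_step (B r)) (0, 0) n s (\<lambda>y. rvseq y 0))" for n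
    unfolding E_def using backward_forward_duality[OF fin nonneg \<pi>,
      where F = "\<lambda>r. mob_step (B r)" and ?y0.0 = "(0, 0)" and h = "\<lambda>r y. snd y"]
    by (simp add: rvseq_def)
  have "coord0 C \<pi> ((Top C Q \<pi> B ^^ n) (\<lambda>s k. seed C Q \<pi> B s k / of_nat d)) = of_real ((E (Suc n) - E n) / real d)" for n
  proof -
    have "E (Suc n) - E n = (\<Sum>s\<in>C. \<pi> s * (backward_mean C Q \<pi> (\<lambda>r. mob_step (B r)) (0, 0) (Suc n) s (\<lambda>y. rvseq y 0)
        - backward_mean C Q \<pi> (\<lambda>r. mob_step (B r)) (0, 0) n s (\<lambda>y. rvseq y 0)))"
      unfolding E by (simp only: sum_subtractf right_diff_distrib)
    then show ?thesis
      by (simp only: Top_iterate[OF pos \<pi>] coord0_def of_real_mult[symmetric] of_real_sum[symmetric]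
          times_divide_eq_right sum_divide_distrib[symmetric])
  qed
  then have "(\<Sum>n<N. coord0 C \<pi> ((Top C Q \<pi> B ^^ n) (\<lambda>s k. seed C Q \<pi> B s k / of_nat d)))
     = of_real ((\<Sum>n<N. E (Suc n) - E n) / real d)"
    by (simp only: of_real_sum[symmetric] sum_divide_distrib)
  also have "(\<Sum>n<N. E (Suc n) - E n) = E N"
    unfolding sum_lessThan_telescope by (simp add: E_def)
  finally show ?thesis unfolding E_def .
qed

section \<open>Positive matrices and logarithmic growth\<close>

text \<open>On positive vectors this is the l1-norm. Its linearity is what makes quotients of
  coordinate sums weighted means of coordinate ratios.\<close>

definition sum_coords :: "real^2 \<Rightarrow> real" where
  "sum_coords v = v $ 1 + v $ 2"

definition pos_vec :: "real^2 \<Rightarrow> bool" where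
  "pos_vec v \<longleftrightarrow> 0 < v $ 1 \<and> 0 < v $ 2"

definition ones :: "real^2" where "ones = vector [1, 1]"

lemma mult_vec_nth_2:
  "(B *v v) $ i = B $ i $ 1 * v $ 1 + B $ i $ 2 * v $ 2" for B :: "real^2^2"
  by (simp add: matrix_vector_mult_def sum_2)

lemma pos_vec_mult:
  "pos_mat B \<Longrightarrow> pos_vec v \<Longrightarrow> pos_vec (B *v v)"
  by (simp add: pos_mat_def pos_vec_def mult_vec_nth_2 add_pos_pos)

abbreviation log_growth :: "'r set \<Rightarrow> ('r \<Rightarrow> 'r \<Rightarrow> real) \<Rightarrow> ('r \<Rightarrow> real^2^2) \<Rightarrow> nat \<Rightarrow> 'r \<Rightarrow> real^2 \<Rightarrow> real" where
  "log_growth C Q B n \<equiv> (chain_op C Q (\<lambda>r v. B r *v v) ^^ n) (\<lambda>r v. ln (sum_coords v))"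

definition log_increment :: "'r set \<Rightarrow> ('r \<Rightarrow> 'r \<Rightarrow> real) \<Rightarrow> ('r \<Rightarrow> real^2^2) \<Rightarrow> nat \<Rightarrow> 'r \<Rightarrow> real^2 \<Rightarrow> real" where
  "log_increment C Q B n r v = log_growth C Q B (Suc n) r v - log_growth C Q B n r v"

lemma log_increment_Suc:
  "log_increment C Q B (Suc n) r v = (\<Sum>s\<in>C. Q r s * log_increment C Q B n s (B r *v v))"
  by (simp add: log_increment_def chain_op_def right_diff_distrib sum_subtractf)

lemma log_increment_0:
  assumes "(\<Sum>s\<in>C. Q r s) = 1"
  shows "log_increment C Q B 0 r v = ln (sum_coords (B r *v v)) - ln (sum_coords v)"
  using assms by (simp add: log_increment_def chain_op_def flip: sum_distrib_right)

definition mob_coord :: "real^2 \<Rightarrow> real" where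
  "mob_coord v = (v $ 1 - v $ 2) / (v $ 1 + v $ 2)"

text \<open>In the coordinates \<open>(v $ 1 - v $ 2, v $ 1 + v $ 2)\<close> the matrix
  \<open>B\<close> has the entries alpha, beta, gamma, delta. Hence numerator and denominator of
  \<open>f\<close> are the difference and the sum of the coordinates of \<open>B *v v\<close>, both
  divided by the coordinate sum of \<open>v\<close>.\<close>

lemma mob_step_coord:
  assumes "pos_mat B" "pos_vec v"
  shows "mob_step B (mob_coord v, c)
     = (mob_coord (B *v v), ln (sum_coords (B *v v)) - ln (sum_coords v))"
proof -
  define s where "s = v$1 + v$2"
  have s: "0 < s" and S: "0 < (B *v v)$1 + (B *v v)$2"
    using assms pos_vec_mult[OF assms] by (auto simp: pos_vec_def s_def)
  have n: "mob_alpha B * mob_coord v + mob_beta B = ((B *v v)$1 - (B *v v)$2) / s"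
    unfolding mob_coord_def s_def[symmetric] mob_alpha_def mob_beta_def mult_vec_nth_2 using s
    by (simp add: field_simps) (simp add: s_def algebra_simps)
  have d: "mob_gamma B * mob_coord v + mob_delta B = ((B *v v)$1 + (B *v v)$2) / s"
    unfolding mob_coord_def s_def[symmetric] mob_gamma_def mob_delta_def mult_vec_nth_2 using s
    by (simp add: field_simps) (simp add: s_def algebra_simps)
  show ?thesis unfolding mob_step_def mob_f_def fst_conv n d using s S
    by (simp add: ln_div mob_coord_def sum_coords_def flip: s_def)
qed

text \<open>Since \<open>mob_step\<close> forgets the second entry, the mean after
  \<open>Suc n\<close> steps keeps only the logarithm gained in the last step, which is an increment
  of the logarithmic growth and not the growth itself.\<close>

lemma chain_op_mob_eq_log_increment:
  assumes row: "\<And>r. r \<in> C \<Longrightarrow> (\<Sum>s\<in>C. Q r s) = 1" and pos: "\<And>r. r \<in> C \<Longrightarrow> pos_mat (B r)"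
    and "r \<in> C" "pos_vec v"
  shows "(chain_op C Q (\<lambda>r. mob_step (B r)) ^^ Suc n) (\<lambda>r y. snd y) r (mob_coord v, c)
     = log_increment C Q B n r v"
  using assms(3,4)
proof (induction n arbitrary: r v c)
  case 0
  then show ?case
    by (simp add: chain_op_def log_increment_0 row mob_step_coord pos flip: sum_distrib_right)
next
  case (Suc n)
  let ?K = "chain_op C Q (\<lambda>r. mob_step (B r))"
  have "(?K ^^ Suc (Suc n)) (\<lambda>r y. snd y) r (mob_coord v, c)
      = (\<Sum>s\<in>C. Q r s * (?K ^^ Suc n) (\<lambda>r y. snd y) s (mob_step (B r) (mob_coord v, c)))"
    by (subst funpow.simps(2), subst o_apply, subst chain_op_def) simp
  also have "\<dots> = (\<Sum>s\<in>C. Q r s * log_increment C Q B n s (B r *v v))"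
    by (intro sum.cong refl)
       (simp only: mob_step_coord[OF pos Suc.prems(2)] Suc.prems Suc.IH pos_vec_mult[OF pos])
  finally show ?case by (simp add: log_increment_Suc)
qed

section \<open>Contraction of coordinate ratios by positive matrices\<close>

lemma weighted_mean_diff_le:
  fixes \<rho>1 \<rho>2 a1 a2 b1 b2 :: real
  assumes "0 < a1" "0 < a2" "0 < b1" "0 < b2"
  shows "\<bar>(\<rho>1 * a1 + \<rho>2 * a2) / (a1 + a2) - (\<rho>1 * b1 + \<rho>2 * b2) / (b1 + b2)\<bar> \<le> \<bar>\<rho>1 - \<rho>2\<bar>"
proof -
  define p q where "p = a1 / (a1 + a2)" and "q = b1 / (b1 + b2)"
  have e: "(\<rho>1 * a1 + \<rho>2 * a2) / (a1 + a2) = \<rho>2 + p * (\<rho>1 - \<rho>2)"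
      "(\<rho>1 * b1 + \<rho>2 * b2) / (b1 + b2) = \<rho>2 + q * (\<rho>1 - \<rho>2)"
    using assms by (simp_all add: p_def q_def field_simps)
  have "0 \<le> p" "p \<le> 1" "0 \<le> q" "q \<le> 1" using assms by (auto simp: p_def q_def)
  then have "\<bar>p - q\<bar> \<le> 1" by linarith
  then have "\<bar>(p - q) * (\<rho>1 - \<rho>2)\<bar> \<le> 1 * \<bar>\<rho>1 - \<rho>2\<bar>" unfolding abs_mult by (intro mult_right_mono) auto
  then show ?thesis unfolding e by (simp add: algebra_simps)
qed

lemma weighted_mean_ge:
  fixes \<rho>1 \<rho>2 a1 a2 :: real
  assumes "0 < a1" "0 < a2" "m \<le> \<rho>1" "m \<le> \<rho>2"
  shows "m \<le> (\<rho>1 * a1 + \<rho>2 * a2) / (a1 + a2)"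
proof -
  have "m * a1 \<le> \<rho>1 * a1" "m * a2 \<le> \<rho>2 * a2" using assms by (auto intro: mult_right_mono)
  then have "m * (a1 + a2) \<le> \<rho>1 * a1 + \<rho>2 * a2" by (simp only: distrib_left)
  then show ?thesis using assms by (simp add: le_divide_eq)
qed

lemma abs_ln_diff_le:
  fixes a b m :: real
  assumes "0 < m" "m \<le> a" "m \<le> b"
  shows "\<bar>ln a - ln b\<bar> \<le> \<bar>a - b\<bar> / m"
proof -
  have *: "ln x - ln y \<le> \<bar>x - y\<bar> / m" if "m \<le> x" "m \<le> y" for x y :: real
  proof -
    have "ln x - ln y \<le> (x - y) / y" using that assms by (intro ln_diff_le) auto
    also have "\<dots> \<le> \<bar>x - y\<bar> / y" using that assms by (intro divide_right_mono) auto
    also have "\<dots> \<le> \<bar>x - y\<bar> / m" using that assms by (intro divide_left_mono) auto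
    finally show ?thesis .
  qed
  show ?thesis using *[of a b] *[of b a] assms by (auto simp: abs_if split: if_splits)
qed

text \<open>A cone of positive vectors with comparable coordinates. A positive matrix whose entries
  are comparable up to the factor \<open>K\<close> maps it into itself, and on it the weights of the
  averaging stay away from \<open>0\<close>.\<close>

definition balanced :: "real \<Rightarrow> real^2 \<Rightarrow> bool" where
  "balanced K v \<longleftrightarrow> pos_vec v \<and> v $ 1 \<le> K * v $ 2 \<and> v $ 2 \<le> K * v $ 1"

text \<open>The ratios of the coordinates of \<open>B v\<close> and \<open>B w\<close> are means of those of \<open>v\<close> and \<open>w\<close>
  with weights bounded away from \<open>0\<close>.\<close>

lemma ratio_contraction:
  fixes \<rho> :: "2 \<Rightarrow> real"
  assumes B: "pos_mat B" and K: "\<And>i j k l. B $ i $ j \<le> K * B $ k $ l"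
    and w: "balanced K w" and v: "v $ 1 = \<rho> 1 * w $ 1" "v $ 2 = \<rho> 2 * w $ 2"
  defines "\<rho>' \<equiv> \<lambda>i. (B *v v) $ i / (B *v w) $ i"
  shows "balanced K (B *v w)"
    and "m \<le> \<rho> 1 \<Longrightarrow> m \<le> \<rho> 2 \<Longrightarrow> m \<le> \<rho>' i"
    and "\<bar>\<rho>' 1 - \<rho>' 2\<bar> \<le> (1 - 1 / (1 + K\<^sup>2)) * \<bar>\<rho> 1 - \<rho> 2\<bar>"
    and "(B *v v) $ i = \<rho>' i * (B *v w) $ i"
proof -
  have wp: "0 < w $ 1" "0 < w $ 2" "w $ 1 \<le> K * w $ 2" "w $ 2 \<le> K * w $ 1"
    using w by (auto simp: balanced_def pos_vec_def)
  note Bp = pos_matD[OF B]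
  have Bw: "0 < (B *v w) $ i" for i
    unfolding mult_vec_nth_2 using Bp wp by (simp add: add_pos_pos)
  have c: "0 < B $ i $ 1 * w $ 1" "0 < B $ i $ 2 * w $ 2" for i using Bp wp by auto
  show "(B *v v) $ i = \<rho>' i * (B *v w) $ i" using Bw[of i] by (simp add: \<rho>'_def)
  have "(B *v w) $ i \<le> K * (B *v w) $ j" for i j
  proof -
    have "(B *v w) $ i \<le> (K * B $ j $ 1) * w $ 1 + (K * B $ j $ 2) * w $ 2"
      unfolding mult_vec_nth_2 using K wp by (intro add_mono mult_right_mono) auto
    then show ?thesis by (simp add: mult_vec_nth_2 algebra_simps)
  qed
  then show "balanced K (B *v w)" using Bw by (simp add: balanced_def pos_vec_def)
  have \<rho>': "\<rho>' i = (\<rho> 1 * (B $ i $ 1 * w $ 1) + \<rho> 2 * (B $ i $ 2 * w $ 2)) / (B $ i $ 1 * w $ 1 + B $ i $ 2 * w $ 2)" for i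
    unfolding \<rho>'_def mult_vec_nth_2 v by (simp add: mult_ac)
  show "m \<le> \<rho> 1 \<Longrightarrow> m \<le> \<rho> 2 \<Longrightarrow> m \<le> \<rho>' i"
    unfolding \<rho>' by (rule weighted_mean_ge[OF c])
  define p where "p i = B $ i $ 1 * w $ 1 / (B $ i $ 1 * w $ 1 + B $ i $ 2 * w $ 2)" for i
  have \<rho>'p: "\<rho>' i = \<rho> 2 + p i * (\<rho> 1 - \<rho> 2)" for i
  proof -
    have "B $ i $ 1 * w $ 1 + B $ i $ 2 * w $ 2 \<noteq> 0" using c[of i] by simp
    then show ?thesis unfolding \<rho>' p_def by (simp add: divide_simps) (simp add: algebra_simps)
  qed
  have K0: "0 < K" using wp by (metis less_le_trans zero_less_mult_pos2)
  \<comment> \<open>One factor \<open>K\<close> comes from the entries of \<open>B\<close>, the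
    other from the coordinates of \<open>w\<close>. So the two unnormalised weights differ by at
    most \<open>K\<^sup>2\<close>, and a normalised weight is at least
    \<open>1 / (1 + K\<^sup>2)\<close>.\<close>
  have le: "B $ i $ 2 * w $ 2 \<le> K\<^sup>2 * (B $ i $ 1 * w $ 1)" "B $ i $ 1 * w $ 1 \<le> K\<^sup>2 * (B $ i $ 2 * w $ 2)" for i
  proof -
    have "B $ i $ 2 * w $ 2 \<le> (K * B $ i $ 1) * (K * w $ 1)" "B $ i $ 1 * w $ 1 \<le> (K * B $ i $ 2) * (K * w $ 2)"
      using K K0 wp Bp[of i 1] Bp[of i 2] by (intro mult_mono; simp add: less_imp_le)+
    then show "B $ i $ 2 * w $ 2 \<le> K\<^sup>2 * (B $ i $ 1 * w $ 1)" "B $ i $ 1 * w $ 1 \<le> K\<^sup>2 * (B $ i $ 2 * w $ 2)"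
      by (simp_all add: power2_eq_square mult_ac)
  qed
  have K1: "0 < 1 + K\<^sup>2" by (simp add: add_pos_nonneg)
  have p1: "1 / (1 + K\<^sup>2) \<le> p i" for i
  proof -
    have "(B $ i $ 1 * w $ 1 + B $ i $ 2 * w $ 2) \<le> (1 + K\<^sup>2) * (B $ i $ 1 * w $ 1)"
      using le(1)[of i] by (simp add: algebra_simps)
    then show ?thesis unfolding p_def using K1 c[of i] by (simp add: divide_simps mult.commute)
  qed
  have p2: "p i \<le> 1" for i unfolding p_def using c[of i] by simp
  \<comment> \<open>Both weights lie in the interval from \<open>1 / (1 + K\<^sup>2)\<close> to
    \<open>1\<close>; its length is the contraction factor.\<close>
  have "\<bar>p 1 - p 2\<bar> \<le> 1 - 1 / (1 + K\<^sup>2)" using p1[of 1] p1[of 2] p2[of 1] p2[of 2] by linarith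
  then have "\<bar>(p 1 - p 2) * (\<rho> 1 - \<rho> 2)\<bar> \<le> (1 - 1 / (1 + K\<^sup>2)) * \<bar>\<rho> 1 - \<rho> 2\<bar>"
    unfolding abs_mult by (intro mult_right_mono) auto
  then show "\<bar>\<rho>' 1 - \<rho>' 2\<bar> \<le> (1 - 1 / (1 + K\<^sup>2)) * \<bar>\<rho> 1 - \<rho> 2\<bar>"
    unfolding \<rho>'p by (simp add: algebra_simps)
qed

text \<open>The vectors \<open>v\<close> and \<open>w\<close> are compared through the ratios
  \<open>\<rho>\<close> of their coordinates. Each step shrinks the oscillation of
  \<open>\<rho>\<close> while the lower bound \<open>m\<close> persists, and at the last step the
  increments differ by the logarithms of two means of \<open>\<rho>\<close>, where \<open>ln\<close>
  has Lipschitz constant \<open>1 / m\<close>.\<close>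

lemma log_increment_contraction:
  fixes \<rho> :: "2 \<Rightarrow> real"
  assumes nonneg: "\<And>r s. r \<in> C \<Longrightarrow> s \<in> C \<Longrightarrow> 0 \<le> Q r s"
    and row: "\<And>r. r \<in> C \<Longrightarrow> (\<Sum>s\<in>C. Q r s) = 1"
    and pos: "\<And>r. r \<in> C \<Longrightarrow> pos_mat (B r)"
    and K: "\<And>r i j k l. r \<in> C \<Longrightarrow> B r $ i $ j \<le> K * B r $ k $ l"
    and m: "0 < m"
    and "r \<in> C" "balanced K w" "v $ 1 = \<rho> 1 * w $ 1" "v $ 2 = \<rho> 2 * w $ 2"
      "m \<le> \<rho> 1" "m \<le> \<rho> 2" 
  shows "\<bar>log_increment C Q B n r v - log_increment C Q B n r w\<bar>
       \<le> (1 - 1 / (1 + K\<^sup>2)) ^ n * (\<bar>\<rho> 1 - \<rho> 2\<bar> / m)"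
  using assms(6-)
proof (induction n arbitrary: r v w \<rho>)
  case 0
  have w: "0 < w $ 1" "0 < w $ 2" using 0 by (auto simp: balanced_def pos_vec_def)
  define b1 b2 where "b1 = (B r $ 1 $ 1 + B r $ 2 $ 1) * w $ 1" and "b2 = (B r $ 1 $ 2 + B r $ 2 $ 2) * w $ 2"
  have b: "0 < b1" "0 < b2" unfolding b1_def b2_def
    using w pos_matD[OF pos[OF 0(1)]] by (auto intro!: mult_pos_pos add_pos_pos)
  define x y where "x = (\<rho> 1 * b1 + \<rho> 2 * b2) / (b1 + b2)" and "y = (\<rho> 1 * w $ 1 + \<rho> 2 * w $ 2) / (w $ 1 + w $ 2)"
  have xy: "m \<le> x" "m \<le> y" unfolding x_def y_def using weighted_mean_ge b w 0 by auto
  have "sum_coords v = y * sum_coords w"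
    using 0 w by (simp add: sum_coords_def y_def)
  moreover have Bw: "sum_coords (B r *v w) = b1 + b2"
    by (simp add: sum_coords_def mult_vec_nth_2 b1_def b2_def algebra_simps)
  moreover have "sum_coords (B r *v v) = x * (b1 + b2)"
  proof -
    have "sum_coords (B r *v v) = \<rho> 1 * b1 + \<rho> 2 * b2"
      using 0 by (simp add: sum_coords_def mult_vec_nth_2 b1_def b2_def algebra_simps)
    then show ?thesis using b by (simp add: x_def)
  qed
  moreover have "0 < sum_coords w" using w by (simp add: sum_coords_def)
  \<comment> \<open>The coordinate sums of \<open>w\<close> and of \<open>B r *v w\<close> cancel.
    What is left are the means \<open>x\<close> and \<open>y\<close> of the same ratios, weighted by
    the column sums of \<open>B r\<close> times the coordinates of \<open>w\<close>, and by the
    coordinates of \<open>w\<close>.\<close>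
  ultimately have "log_increment C Q B 0 r v - log_increment C Q B 0 r w = ln x - ln y"
    using xy m b by (simp add: log_increment_0 row 0(1) ln_mult)
  also have "\<bar>\<dots>\<bar> \<le> \<bar>x - y\<bar> / m" by (rule abs_ln_diff_le[OF m xy])
  also have "\<dots> \<le> \<bar>\<rho> 1 - \<rho> 2\<bar> / m"
    unfolding x_def y_def using m b w by (intro divide_right_mono weighted_mean_diff_le) auto
  finally show ?case by simp
next
  case (Suc n)
  define \<kappa> where "\<kappa> = 1 - 1 / (1 + K\<^sup>2)"
  have \<kappa>: "0 \<le> \<kappa>" by (simp add: \<kappa>_def divide_le_eq add_pos_nonneg)
  define \<rho>' where "\<rho>' i = (B r *v v) $ i / (B r *v w) $ i" for i
  note rc = ratio_contraction[OF pos[OF Suc.prems(1)] K[OF Suc.prems(1)] Suc.prems(2-4), folded \<rho>'_def \<kappa>_def]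
  have step: "\<bar>log_increment C Q B n s (B r *v v) - log_increment C Q B n s (B r *v w)\<bar>
      \<le> \<kappa> ^ Suc n * (\<bar>\<rho> 1 - \<rho> 2\<bar> / m)" if "s \<in> C" for s
  proof -
    have "\<bar>log_increment C Q B n s (B r *v v) - log_increment C Q B n s (B r *v w)\<bar>
      \<le> \<kappa> ^ n * (\<bar>\<rho>' 1 - \<rho>' 2\<bar> / m)"
      unfolding \<kappa>_def by (rule Suc.IH[OF that rc(1,4,4)]) (use rc(2) Suc.prems in auto)
    also have "\<dots> \<le> \<kappa> ^ n * (\<kappa> * \<bar>\<rho> 1 - \<rho> 2\<bar> / m)"
      using rc(3) m \<kappa> by (intro mult_left_mono divide_right_mono) auto
    finally show ?thesis by (simp add: mult_ac)
  qed
  have "\<bar>log_increment C Q B (Suc n) r v - log_increment C Q B (Suc n) r w\<bar>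
     = \<bar>\<Sum>s\<in>C. Q r s * (log_increment C Q B n s (B r *v v) - log_increment C Q B n s (B r *v w))\<bar>"
    by (simp add: log_increment_Suc right_diff_distrib sum_subtractf)
  also have "\<dots> \<le> (\<Sum>s\<in>C. Q r s * (\<kappa> ^ Suc n * (\<bar>\<rho> 1 - \<rho> 2\<bar> / m)))"
    using nonneg[OF Suc.prems(1)] step
    by (intro order_trans[OF sum_abs] sum_mono) (simp only: abs_mult abs_of_nonneg mult_left_mono)
  also have "\<dots> = \<kappa> ^ Suc n * (\<bar>\<rho> 1 - \<rho> 2\<bar> / m)"
    using row[OF Suc.prems(1)] by (simp only: sum_distrib_right[symmetric] mult_1_left)
  finally show ?case unfolding \<kappa>_def .
qed

section \<open>Convergence of the increments and the value of the series\<close>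

lemma LIMSEQ_cesaro:
  fixes a :: "nat \<Rightarrow> real"
  assumes "a \<longlonglongrightarrow> l"
  shows "(\<lambda>n. (\<Sum>k<n. a k) / real n) \<longlonglongrightarrow> l"
proof (rule LIMSEQ_I)
  fix e :: real assume e: "0 < e"
  obtain N where N: "\<And>n. n \<ge> N \<Longrightarrow> \<bar>a n - l\<bar> < e / 2"
    using LIMSEQ_D[OF assms, of "e / 2"] e by auto
  define c where "c = (\<Sum>k<N. \<bar>a k - l\<bar>)"
  obtain n1 :: nat where n1: "2 * c / e < n1" using reals_Archimedean2 by blast
  show "\<exists>n0. \<forall>n\<ge>n0. norm ((\<Sum>k<n. a k) / real n - l) < e"
  proof (intro exI allI impI)
    fix n assume n: "n \<ge> max (max N n1) 1"
    have "(\<Sum>k<n. a k) - real n * l = (\<Sum>k<n. a k - l)" by (simp add: sum_subtractf)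
    also have "\<bar>\<dots>\<bar> \<le> (\<Sum>k<n. \<bar>a k - l\<bar>)" by (rule sum_abs)
    also have "\<dots> \<le> c + real (n - N) * (e / 2)"
    proof -
      have "(\<Sum>k<n. \<bar>a k - l\<bar>) = c + (\<Sum>k\<in>{N..<n}. \<bar>a k - l\<bar>)"
        unfolding c_def using n by (simp add: lessThan_atLeast0 sum.atLeastLessThan_concat)
      also have "(\<Sum>k\<in>{N..<n}. \<bar>a k - l\<bar>) \<le> (\<Sum>k\<in>{N..<n}. e / 2)"
        using N by (intro sum_mono) (auto intro: less_imp_le)
      finally show ?thesis by simp
    qed
    also have "\<dots> \<le> c + real n * (e / 2)" using e by (intro add_left_mono mult_right_mono) auto
    also have "c < real n * (e / 2)"
    proof -
      have "2 * c / e < real n" using n1 n by linarith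
      then show ?thesis using e by (simp add: field_simps)
    qed
    finally have "\<bar>(\<Sum>k<n. a k) - real n * l\<bar> < e * real n" by (simp add: algebra_simps)
    then have "\<bar>(\<Sum>k<n. a k) - real n * l\<bar> / real n < e" using n by (simp add: pos_divide_less_eq)
    moreover have "(\<Sum>k<n. a k) / real n - l = ((\<Sum>k<n. a k) - real n * l) / real n"
      using n by (simp add: field_simps)
    ultimately show "norm ((\<Sum>k<n. a k) / real n - l) < e" by (simp add: abs_divide)
  qed
qed

lemma convergent_if_geometric_increments:
  fixes a :: "nat \<Rightarrow> real"
  assumes "\<And>n. \<bar>a (Suc n) - a n\<bar> \<le> \<kappa> ^ n * c" "0 \<le> \<kappa>" "\<kappa> < 1"
  shows "convergent a"
proof -
  have "summable (\<lambda>n. \<kappa> ^ n * c)" using assms by (intro summable_mult2 summable_geometric) auto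
  then have "summable (\<lambda>n. a (Suc n) - a n)"
    by (rule summable_comparison_test') (use assms in auto)
  then have "convergent (\<lambda>n. \<Sum>k<n. a (Suc k) - a k)" by (simp add: summable_iff_convergent)
  then have "convergent (\<lambda>n. a n - a 0)" by (simp add: sum_lessThan_telescope)
  then show ?thesis by (metis convergent_diff_const_right_iff)
qed

lemma pos_mat_family_ratio_bound:
  assumes "finite C" "\<And>r. r \<in> C \<Longrightarrow> pos_mat (B r)"
  obtains K where "1 \<le> K" "\<And>r i j k l. r \<in> C \<Longrightarrow> B r $ i $ j \<le> K * B r $ k $ l"
proof -
  \<comment> \<open>The inserted \<open>1\<close> ensures \<open>1 \<le> K\<close>, so that the
    vector \<open>ones\<close> is balanced.\<close>
  let ?S = "insert 1 ((\<lambda>(r, i, j, k, l). B r $ i $ j / B r $ k $ l) ` (C \<times> UNIV \<times> UNIV \<times> UNIV \<times> UNIV))"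
  have fin: "finite ?S" using assms(1) by auto
  have "B r $ i $ j \<le> Max ?S * B r $ k $ l" if "r \<in> C" for r i j k l
  proof -
    have "B r $ i $ j / B r $ k $ l \<in> ?S"
      by (intro insertI2 image_eqI[where x = "(r, i, j, k, l)"]) (use that in auto)
    then have "B r $ i $ j / B r $ k $ l \<le> Max ?S" using fin by (rule Max_ge[rotated])
    then show ?thesis using pos_matD[OF assms(2)[OF that]] by (simp add: divide_le_eq)
  qed
  moreover have "1 \<le> Max ?S" using fin by (intro Max_ge) auto
  ultimately show thesis using that by blast
qed

lemma balanced_ones: "1 \<le> K \<Longrightarrow> balanced K ones"
  by (simp add: balanced_def pos_vec_def ones_def vector_2)

lemma coord0_series_sums:
  assumes fin: "finite C" and nonneg: "\<And>r s. r \<in> C \<Longrightarrow> s \<in> C \<Longrightarrow> 0 \<le> Q r s"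
    and row: "\<And>r. r \<in> C \<Longrightarrow> (\<Sum>s\<in>C. Q r s) = 1"
    and pos: "\<And>r. r \<in> C \<Longrightarrow> pos_mat (B r)"
    and \<pi>: "stationary_on C Q \<pi>"
    and growth: "\<And>r. r \<in> C \<Longrightarrow> (\<lambda>n. log_growth C Q B n r ones / real n) \<longlonglongrightarrow> \<Lambda>"
  shows "(\<lambda>n. coord0 C \<pi> ((Top C Q \<pi> B ^^ n) (\<lambda>s k. seed C Q \<pi> B s k / of_nat d)))
           sums of_real (\<Lambda> / real d)"
proof -
  let ?J = "log_increment C Q B"
  define E where "E n = (\<Sum>r\<in>C. \<pi> r * ?J n r ones)" for n
  obtain K where K: "1 \<le> K" "\<And>r i j k l. r \<in> C \<Longrightarrow> B r $ i $ j \<le> K * B r $ k $ l"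
    using pos_mat_family_ratio_bound[where C = C and B = B] fin pos by blast
  have one: "ones $ 1 = 1" "ones $ 2 = 1" by (simp_all add: ones_def vector_2)
  define \<kappa> where "\<kappa> = 1 - 1 / (1 + K\<^sup>2)"
  have \<kappa>: "0 \<le> \<kappa>" "\<kappa> < 1" by (auto simp: \<kappa>_def divide_le_eq add_pos_nonneg)
  have \<pi>0: "\<And>r. r \<in> C \<Longrightarrow> 0 \<le> \<pi> r" and \<pi>1: "(\<Sum>r\<in>C. \<pi> r) = 1"
    and \<pi>Q: "\<And>s. s \<in> C \<Longrightarrow> (\<Sum>r\<in>C. \<pi> r * Q r s) = \<pi> s" using \<pi> by (auto simp: stationary_on_def)
  have dif: "\<exists>c. \<forall>n. \<bar>?J n s (B r *v ones) - ?J n s ones\<bar> \<le> \<kappa> ^ n * c" if r: "r \<in> C" "s \<in> C" for r s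
  proof -
    define \<rho> where "\<rho> i = (B r *v ones) $ i" for i
    define m where "m = min (\<rho> 1) (\<rho> 2)"
    have "0 < m" using pos_vec_mult[OF pos[OF r(1)], of ones] by (simp add: m_def \<rho>_def pos_vec_def one)
    then have "\<bar>?J n s (B r *v ones) - ?J n s ones\<bar> \<le> \<kappa> ^ n * (\<bar>\<rho> 1 - \<rho> 2\<bar> / m)" for n
      unfolding \<kappa>_def
      by (intro log_increment_contraction[OF nonneg row pos K(2)] r balanced_ones K(1))
         (auto simp: one m_def \<rho>_def)
    then show ?thesis by blast
  qed
  then obtain c where c: "\<And>r s n. r \<in> C \<Longrightarrow> s \<in> C \<Longrightarrow> \<bar>?J n s (B r *v ones) - ?J n s ones\<bar> \<le> \<kappa> ^ n * c r s"
    by metis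
  have inc: "\<bar>E (Suc n) - E n\<bar> \<le> \<kappa> ^ n * (\<Sum>r\<in>C. \<Sum>s\<in>C. \<pi> r * Q r s * c r s)" for n
  proof -
    \<comment> \<open>Stationarity inserts an idle first transition from \<open>r\<close> to
      \<open>s\<close>. After this \<open>E n\<close> and \<open>E (Suc n)\<close> are sums over the
      same transitions and differ only in starting from \<open>ones\<close> or from
      \<open>B r *v ones\<close>.\<close>
    have "E n = (\<Sum>s\<in>C. (\<Sum>r\<in>C. \<pi> r * Q r s) * ?J n s ones)" unfolding E_def using \<pi>Q by simp
    also have "\<dots> = (\<Sum>r\<in>C. \<Sum>s\<in>C. \<pi> r * Q r s * ?J n s ones)"
      unfolding sum_distrib_right by (rule sum.swap)
    finally have "E (Suc n) - E n = (\<Sum>r\<in>C. \<Sum>s\<in>C. \<pi> r * Q r s * (?J n s (B r *v ones) - ?J n s ones))"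
      unfolding E_def log_increment_Suc
      by (simp add: sum_distrib_left right_diff_distrib sum_subtractf mult.assoc)
    also have "\<bar>\<dots>\<bar> \<le> (\<Sum>r\<in>C. \<Sum>s\<in>C. \<pi> r * Q r s * (\<kappa> ^ n * c r s))"
    proof (intro order_trans[OF sum_abs] sum_mono)
      fix r s assume r: "r \<in> C" "s \<in> C"
      have "0 \<le> \<pi> r * Q r s" using \<pi>0 nonneg r by simp
      then show "\<bar>\<pi> r * Q r s * (?J n s (B r *v ones) - ?J n s ones)\<bar> \<le> \<pi> r * Q r s * (\<kappa> ^ n * c r s)"
        unfolding abs_mult[of "\<pi> r * Q r s"] using c[OF r] by (simp only: abs_of_nonneg mult_left_mono)
    qed
    finally show ?thesis by (simp add: sum_distrib_left mult_ac)
  qed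
  have "convergent E" by (rule convergent_if_geometric_increments[OF inc \<kappa>])
  then obtain e where e: "E \<longlonglongrightarrow> e" by (auto simp: convergent_def)
  have "(\<lambda>n. (\<Sum>k<n. E k) / real n) \<longlonglongrightarrow> \<Lambda>"
  proof -
    let ?G = "\<lambda>n r. log_growth C Q B n r ones"
    have "(\<Sum>k<n. E k) / real n = (\<Sum>r\<in>C. \<pi> r * (?G n r / real n - ?G 0 r / real n))" for n
    proof -
      have "(\<Sum>k<n. E k) = (\<Sum>r\<in>C. \<pi> r * (\<Sum>k<n. ?J k r ones))"
        unfolding E_def sum_distrib_left by (rule sum.swap)
      also have "\<dots> = (\<Sum>r\<in>C. \<pi> r * (?G n r - ?G 0 r))"
        unfolding log_increment_def
        by (intro sum.cong refl arg_cong2[where f = "(*)"]) (rule sum_lessThan_telescope)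
      finally show ?thesis by (simp only: sum_divide_distrib diff_divide_distrib[symmetric] times_divide_eq_right)
    qed
    moreover have "(\<lambda>n. \<Sum>r\<in>C. \<pi> r * (?G n r / real n - ?G 0 r / real n)) \<longlonglongrightarrow> (\<Sum>r\<in>C. \<pi> r * (\<Lambda> - 0))"
      by (intro tendsto_sum tendsto_mult tendsto_const tendsto_diff growth lim_const_over_n)
    ultimately show ?thesis using \<pi>1 by (simp flip: sum_distrib_right)
  qed
  then have "e = \<Lambda>" using LIMSEQ_cesaro[OF e] LIMSEQ_unique by blast
  then have "(\<lambda>n. E n / real d) \<longlonglongrightarrow> \<Lambda> / real d" using e by (simp add: divide_inverse tendsto_mult_right)
  moreover have "E n = (\<Sum>r\<in>C. \<pi> r * (chain_op C Q (\<lambda>r. mob_step (B r)) ^^ Suc n) (\<lambda>r y. snd y) r (0, 0))" for n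
  proof -
    have "pos_vec ones" "mob_coord ones = 0" by (simp_all add: pos_vec_def mob_coord_def one)
    then show ?thesis unfolding E_def
      using chain_op_mob_eq_log_increment[OF row pos, where v = ones and c = 0] by (intro sum.cong) auto
  qed
  \<comment> \<open>The expression at \<open>Suc n\<close> is \<open>E n / real d\<close>; the shift
    of the index does not affect the limit.\<close>
  ultimately have "(\<lambda>n. (\<Sum>r\<in>C. \<pi> r * (chain_op C Q (\<lambda>r. mob_step (B r)) ^^ n) (\<lambda>r y. snd y) r (0, 0)) / real d)
      \<longlonglongrightarrow> \<Lambda> / real d"
    by (subst filterlim_sequentially_Suc[symmetric]) (simp only:)
  moreover have "(\<Sum>n<N. coord0 C \<pi> ((Top C Q \<pi> B ^^ n) (\<lambda>s k. seed C Q \<pi> B s k / of_nat d)))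
    = of_real ((\<Sum>r\<in>C. \<pi> r * (chain_op C Q (\<lambda>r. mob_step (B r)) ^^ N) (\<lambda>r y. snd y) r (0, 0)) / real d)" for N
    by (rule coord0_partial_sums[OF fin nonneg pos \<pi>])
  ultimately show ?thesis
    unfolding sums_def by (simp only: tendsto_of_real_iff)
qed

section \<open>The aperiodic reduction\<close>

text \<open>Unlike \<^const>\<open>chain_op\<close>, which applies the map of the current state and then moves,
  \<open>step_mean\<close> moves first; this is the convention under which a block of \<open>d\<close> steps is one step of the
  reduced chain.\<close>

definition step_mean ::
  "'r set \<Rightarrow> ('r \<Rightarrow> 'r \<Rightarrow> real) \<Rightarrow> ('r \<Rightarrow> 'y \<Rightarrow> 'y) \<Rightarrow> ('r \<Rightarrow> 'y \<Rightarrow> real) \<Rightarrow> 'r \<Rightarrow> 'y \<Rightarrow> real" where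
  "step_mean C Q F h r y = (\<Sum>s\<in>C. Q r s * h s (F s y))"

lemma chain_op_Suc: "(chain_op C Q F ^^ Suc n) h r y = (\<Sum>s\<in>C. Q r s * (chain_op C Q F ^^ n) h s (F r y))"
  by (subst funpow.simps(2), subst o_apply, subst chain_op_def) simp

lemma step_mean_Suc: "(step_mean C Q F ^^ Suc n) h r y = (\<Sum>s\<in>C. Q r s * (step_mean C Q F ^^ n) h s (F s y))"
  by (subst funpow.simps(2), subst o_apply, subst step_mean_def) simp

text \<open>The first map is applied without a move and is pulled out in front. At the other end the
  last move has no effect, since \<open>\<phi>\<close> ignores the state and the rows of
  \<open>Q\<close> sum to \<open>1\<close>.\<close>

lemma chain_op_Suc_eq_step_mean:
  assumes row: "\<And>r. r \<in> C \<Longrightarrow> (\<Sum>s\<in>C. Q r s) = 1" and "r \<in> C"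
  shows "(chain_op C Q F ^^ Suc n) (\<lambda>r. \<phi>) r y = (step_mean C Q F ^^ n) (\<lambda>r. \<phi>) r (F r y)"
  using assms(2)
proof (induction n arbitrary: r y)
  case 0
  then show ?case by (simp add: chain_op_def row flip: sum_distrib_right)
next
  case (Suc n)
  have "(chain_op C Q F ^^ Suc (Suc n)) (\<lambda>r. \<phi>) r y
      = (\<Sum>s\<in>C. Q r s * (chain_op C Q F ^^ Suc n) (\<lambda>r. \<phi>) s (F r y))"
    by (rule chain_op_Suc)
  also have "\<dots> = (\<Sum>s\<in>C. Q r s * (step_mean C Q F ^^ n) (\<lambda>r. \<phi>) s (F s (F r y)))"
    by (intro sum.cong refl) (simp only: Suc.IH)
  finally show ?case unfolding step_mean_Suc .
qed

fun path_weight :: "('r \<Rightarrow> 'r \<Rightarrow> real) \<Rightarrow> 'r \<Rightarrow> 'r list \<Rightarrow> real" where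
  "path_weight Q r [] = 1"
| "path_weight Q r (s # l) = Q r s * path_weight Q s l"

lemma sum_lists_Suc:
  assumes "finite C"
  shows "(\<Sum>l\<in>{l. set l \<subseteq> C \<and> length l = Suc n}. f l)
           = (\<Sum>s\<in>C. \<Sum>l\<in>{l. set l \<subseteq> C \<and> length l = n}. f (s # l))"
proof -
  have "{l. set l \<subseteq> C \<and> length l = Suc n} = (\<lambda>(s, l). s # l) ` (C \<times> {l. set l \<subseteq> C \<and> length l = n})"
    by (auto simp: length_Suc_conv)
  moreover have "inj_on (\<lambda>(s, l). s # l) (C \<times> {l. set l \<subseteq> C \<and> length l = n})"
    by (auto simp: inj_on_def)
  ultimately show ?thesis by (simp add: sum.reindex sum.cartesian_product case_prod_unfold)
qed

lemma step_mean_funpow: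
  assumes "finite C"
  shows "(step_mean C Q F ^^ n) h r y
    = (\<Sum>l\<in>{l. set l \<subseteq> C \<and> length l = n}. path_weight Q r l * h (last (r # l)) (fold F l y))"
proof (induction n arbitrary: r y)
  case 0
  have "{l. set l \<subseteq> C \<and> length l = 0} = {[]}" by auto
  then show ?case by simp
next
  case (Suc n)
  have "(step_mean C Q F ^^ Suc n) h r y = (\<Sum>s\<in>C. Q r s * (step_mean C Q F ^^ n) h s (F s y))"
    by (rule step_mean_Suc)
  then show ?case unfolding sum_lists_Suc[OF assms] Suc.IH by (simp add: sum_distrib_left mult.assoc)
qed

lemma path_weight_eq_prod:
  "path_weight Q r l = (\<Prod>u<length l. Q ((r # l) ! u) (l ! u))"
  by (induction l arbitrary: r) (simp_all add: prod.lessThan_Suc_shift del: prod.lessThan_Suc)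

text \<open>A reduced transition depends on its source only through the last entry: it is a path of
  the original chain that starts there and runs through \<open>c'\<close>.\<close>

lemma redQ_eq_path_weight: "c' \<noteq> [] \<Longrightarrow> redQ Q c c' = path_weight Q (last c) c'"
  by (cases c') (simp_all add: redQ_def path_weight_eq_prod prod.lessThan_Suc_shift del: prod.lessThan_Suc)

lemma path_weight_nonneg:
  assumes nonneg: "\<And>r s. r \<in> C \<Longrightarrow> s \<in> C \<Longrightarrow> 0 \<le> Q r s"
  shows "r \<in> C \<Longrightarrow> set l \<subseteq> C \<Longrightarrow> 0 \<le> path_weight Q r l"
  by (induction l arbitrary: r) (auto simp: nonneg)

lemma rpow_nonneg:
  assumes nonneg: "\<And>r s. r \<in> C \<Longrightarrow> s \<in> C \<Longrightarrow> 0 \<le> Q r s"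
  shows "s \<in> C \<Longrightarrow> 0 \<le> rpow C Q n r s"
  by (induction n arbitrary: s) (auto intro!: sum_nonneg mult_nonneg_nonneg nonneg)

lemma rpow_Suc_pos:
  assumes "finite C" and nonneg: "\<And>r s. r \<in> C \<Longrightarrow> s \<in> C \<Longrightarrow> 0 \<le> Q r s"
    and "s \<in> C" "t \<in> C" "0 < rpow C Q n r s" "0 < Q s t"
  shows "0 < rpow C Q (Suc n) r t"
proof -
  have "0 < rpow C Q n r s * Q s t" using assms by simp
  also have "\<dots> \<le> (\<Sum>c\<in>C. rpow C Q n r c * Q c t)"
    using assms rpow_nonneg[where C = C and Q = Q] by (intro member_le_sum) auto
  finally show ?thesis by simp
qed

lemma rpow_along_path:
  assumes "finite C" and nonneg: "\<And>r s. r \<in> C \<Longrightarrow> s \<in> C \<Longrightarrow> 0 \<le> Q r s"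
    and "r \<in> C" "set l \<subseteq> C" "path_weight Q r l \<noteq> 0" "0 < rpow C Q n rs r" "u < length l"
  shows "0 < rpow C Q (n + Suc u) rs (l ! u) \<and> (Suc u < length l \<longrightarrow> 0 < Q (l ! u) (l ! Suc u))"
  using assms(3-)
proof (induction l arbitrary: r n u)
  case (Cons s l)
  have s: "s \<in> C" "0 < Q r s" using Cons.prems nonneg[of r s] by (auto simp: less_le)
  have pos: "0 < rpow C Q (Suc n) rs s"
    by (rule rpow_Suc_pos[OF assms(1), of Q r s n rs]) (use Cons.prems s nonneg in auto)
  show ?case
  proof (cases u)
    case 0
    have "0 < Q s (l ! 0)" if "l \<noteq> []"
      using that Cons.prems nonneg[OF s(1), of "l ! 0"] by (cases l) (auto simp: less_le)
    then show ?thesis using pos 0 by simp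
  next
    case (Suc v)
    then show ?thesis using Cons.IH[OF s(1) _ _ pos, of v] Cons.prems by simp
  qed
qed simp

section \<open>Blocks of one period as steps of the reduced chain\<close>

locale recurrent_chain =
  fixes C :: "'r set" and Q :: "'r \<Rightarrow> 'r \<Rightarrow> real" and rs :: 'r
  assumes finite_C: "finite C" and rs: "rs \<in> C"
    and nonneg: "\<And>r s. r \<in> C \<Longrightarrow> s \<in> C \<Longrightarrow> 0 \<le> Q r s"
    and row_sum: "\<And>r. r \<in> C \<Longrightarrow> (\<Sum>s\<in>C. Q r s) = 1"
    and returns: "\<exists>n\<ge>1. 0 < rpow C Q n rs rs"
begin

abbreviation "d \<equiv> period C Q rs"

lemma period_pos: "0 < d"
proof -
  obtain n where n: "n \<ge> 1" "0 < rpow C Q n rs rs" using returns by blast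
  then have "d dvd n" unfolding period_def by (intro Gcd_dvd) simp
  then show ?thesis using n by (metis dvd_0_left_iff gr0I not_one_le_zero)
qed

lemma redC_D:
  assumes "c \<in> redC C Q rs"
  shows "length c = d" "c \<noteq> []" "set c \<subseteq> C" "last c \<in> C" "last c \<in> cyc_class C Q rs (d - 1)"
proof -
  have c: "length c = d" "\<And>u. u < d \<Longrightarrow> c ! u \<in> cyc_class C Q rs u" using assms by (auto simp: redC_def Let_def)
  then show "length c = d" "c \<noteq> []" using period_pos by auto
  then show "last c \<in> cyc_class C Q rs (d - 1)" using c period_pos by (simp add: last_conv_nth)
  then show "last c \<in> C" by (simp add: cyc_class_def)
  show "set c \<subseteq> C" using c by (auto simp: set_conv_nth cyc_class_def)
qed

lemma finite_redC: "finite (redC C Q rs)"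
  by (rule finite_subset[OF _ finite_lists_length_eq[OF finite_C, of d]]) (use redC_D in auto)

text \<open>The last entry of \<open>c\<close> lies in the cyclic class \<open>d - 1\<close>, so
  every path of nonzero weight from it enters class \<open>0\<close> and runs through the classes in
  order. The constraints in \<open>redC\<close> thus exclude only paths of weight
  \<open>0\<close>.\<close>

lemma path_in_redC:
  assumes c: "c \<in> redC C Q rs" and l: "set l \<subseteq> C" "length l = d" "path_weight Q (last c) l \<noteq> 0"
  shows "l \<in> redC C Q rs"
proof -
  obtain n where n: "n mod d = d - 1" "0 < rpow C Q n rs (last c)"
    using redC_D(5)[OF c] by (auto simp: cyc_class_def)
  have *: "0 < rpow C Q (n + Suc u) rs (l ! u) \<and> (Suc u < length l \<longrightarrow> 0 < Q (l ! u) (l ! Suc u))" if "u < d" for u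
    by (rule rpow_along_path[OF finite_C nonneg redC_D(4)[OF c]]) (use l n that in auto)
  \<comment> \<open>The entry \<open>l ! u\<close> is reached \<open>Suc u\<close> steps after
    \<open>last c\<close>, whose time is congruent to \<open>d - 1\<close>.\<close>
  have m: "(n + Suc u) mod d = u" if "u < d" for u
  proof -
    have "(n + Suc u) mod d = (n mod d + Suc u) mod d" by (simp only: mod_add_left_eq)
    also have "n mod d + Suc u = d + u" using n(1) period_pos by simp
    finally show ?thesis using that by simp
  qed
  have "l ! u \<in> cyc_class C Q rs u" if "u < d" for u
    unfolding cyc_class_def using *[OF that] m[OF that] that l(1,2)
    by (intro CollectI conjI exI[of _ "n + Suc u"]) auto
  then show ?thesis using l * by (simp add: redC_def Let_def)
qed

lemma step_mean_redC:
  assumes "c \<in> redC C Q rs"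
  shows "step_mean (redC C Q rs) (redQ Q) (fold F) (\<lambda>c. h (last c)) c y = (step_mean C Q F ^^ d) h (last c) y"
proof -
  have "step_mean (redC C Q rs) (redQ Q) (fold F) (\<lambda>c. h (last c)) c y
      = (\<Sum>l\<in>redC C Q rs. path_weight Q (last c) l * h (last (last c # l)) (fold F l y))"
    unfolding step_mean_def by (intro sum.cong refl) (use redC_D in \<open>auto simp: redQ_eq_path_weight\<close>)
  also have "\<dots> = (\<Sum>l\<in>{l. set l \<subseteq> C \<and> length l = d}. path_weight Q (last c) l * h (last (last c # l)) (fold F l y))"
    using path_in_redC[OF assms]
    by (intro sum.mono_neutral_left finite_lists_length_eq[OF finite_C])
       (auto simp: redC_D(1) dest: subsetD[OF redC_D(3)])
  finally show ?thesis unfolding step_mean_funpow[OF finite_C] .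
qed

lemma step_mean_redC_funpow:
  assumes "c \<in> redC C Q rs"
  shows "(step_mean (redC C Q rs) (redQ Q) (fold F) ^^ n) (\<lambda>c. \<phi>) c y
    = (step_mean C Q F ^^ (d * n)) (\<lambda>r. \<phi>) (last c) y"
  using assms
proof (induction n arbitrary: c y)
  case (Suc n)
  let ?h = "(step_mean C Q F ^^ (d * n)) (\<lambda>r. \<phi>)"
  have "(step_mean (redC C Q rs) (redQ Q) (fold F) ^^ Suc n) (\<lambda>c. \<phi>) c y
     = step_mean (redC C Q rs) (redQ Q) (fold F) (\<lambda>c. ?h (last c)) c y"
    unfolding funpow.simps o_apply by (subst (1 2) step_mean_def) (intro sum.cong refl, simp only: Suc.IH)
  also have "\<dots> = (step_mean C Q F ^^ d) ?h (last c) y" by (rule step_mean_redC[OF Suc.prems])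
  finally show ?case by (simp add: funpow_add)
qed simp

lemma redQ_nonneg:
  assumes "c \<in> redC C Q rs" "c' \<in> redC C Q rs"
  shows "0 \<le> redQ Q c c'"
  using redC_D[OF assms(1)] redC_D[OF assms(2)] path_weight_nonneg[OF nonneg]
  by (simp add: redQ_eq_path_weight)

lemma redQ_row_sum:
  assumes "c \<in> redC C Q rs"
  shows "(\<Sum>c'\<in>redC C Q rs. redQ Q c c') = 1"
proof -
  \<comment> \<open>The row sums are read off from the block identity with the constant function
    \<open>1\<close>; the identity maps on \<open>nat\<close> serve only as a dummy
    dynamics.\<close>
  have "(step_mean C Q (\<lambda>r y. y) ^^ n) (\<lambda>r y. 1) r y = 1" if "r \<in> C" for n r and y :: nat
    using that
  proof (induction n arbitrary: r)
    case (Suc n)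
    have "(step_mean C Q (\<lambda>r y. y) ^^ Suc n) (\<lambda>r y. 1) r y
        = (\<Sum>s\<in>C. Q r s * (step_mean C Q (\<lambda>r y. y) ^^ n) (\<lambda>r y. 1) s y)" by (rule step_mean_Suc)
    also have "\<dots> = (\<Sum>s\<in>C. Q r s)" by (intro sum.cong) (auto simp: Suc.IH)
    finally show ?case using row_sum Suc.prems by simp
  qed simp
  then have "(step_mean C Q (\<lambda>r y. y) ^^ d) (\<lambda>r y. 1) (last c) (0::nat) = 1" using redC_D(4)[OF assms] by blast
  then show ?thesis
    using step_mean_redC[OF assms, where F = "\<lambda>r y. y" and h = "\<lambda>r y. 1" and y = "0::nat"] by (simp add: step_mean_def)
qed

end

lemma fold_mult_vec:
  "fold (\<lambda>r v. B r *v v) c (N *v v) = fold (\<lambda>r N. B r ** N) c N *v v" for N :: "real^2^2"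
  by (induction c arbitrary: N) (auto simp: matrix_vector_mul_assoc)

lemma redB_mult_vec: "redB B c *v v = fold (\<lambda>r v. B r *v v) c v"
  unfolding redB_def fold_mult_vec[symmetric] by simp

lemma pos_mat_mult:
  "pos_mat M \<Longrightarrow> pos_mat N \<Longrightarrow> pos_mat (M ** N)"
  by (simp add: pos_mat_def matrix_matrix_mult_def sum_2 add_pos_pos)

lemma pos_mat_redB:
  assumes "c \<noteq> []" "\<And>r. r \<in> set c \<Longrightarrow> pos_mat (B r)"
  shows "pos_mat (redB B c)"
proof -
  have "pos_mat (fold (\<lambda>r N. B r ** N) l N)" if "pos_mat N" "\<And>r. r \<in> set l \<Longrightarrow> pos_mat (B r)" for l N
    using that by (induction l arbitrary: N) (auto simp: pos_mat_mult)
  then show ?thesis using assms by (cases c) (auto simp: redB_def)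
qed

lemma det_redB_nonzero:
  assumes "\<And>r. r \<in> set c \<Longrightarrow> det (B r) \<noteq> 0"
  shows "det (redB B c) \<noteq> 0"
proof -
  have "det (fold (\<lambda>r N. B r ** N) l N) \<noteq> 0" if "det N \<noteq> 0" "\<And>r. r \<in> set l \<Longrightarrow> det (B r) \<noteq> 0" for l N
    using that by (induction l arbitrary: N) (auto simp: det_mul)
  then show ?thesis using assms by (auto simp: redB_def)
qed

context recurrent_chain
begin

text \<open>The initial block \<open>c\<close> acts deterministically, so the original chain starts
  at \<open>last c\<close> from \<open>redB B c *v ones\<close>. This is why the growth is assumed
  for arbitrary positive invertible \<open>N\<close> in front of \<open>ones\<close>. The factor
  \<open>d\<close> appears because one reduced step consists of \<open>d\<close> original
  ones.\<close>

lemma reduced_log_growth: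
  assumes growth: "\<And>r N. r \<in> C \<Longrightarrow> pos_mat N \<Longrightarrow> det N \<noteq> 0 \<Longrightarrow>
      (\<lambda>n. (step_mean C Q (\<lambda>r v. B r *v v) ^^ n) (\<lambda>r v. ln (sum_coords v)) r (N *v ones) / real n) \<longlonglongrightarrow> lam"
    and pos: "\<And>r. r \<in> C \<Longrightarrow> pos_mat (B r)" and det: "\<And>r. r \<in> C \<Longrightarrow> det (B r) \<noteq> 0"
    and c: "c \<in> redC C Q rs"
  shows "(\<lambda>n. log_growth (redC C Q rs) (redQ Q) (redB B) n c ones / real n) \<longlonglongrightarrow> real d * lam"
proof -
  define X where "X n = (step_mean C Q (\<lambda>r v. B r *v v) ^^ n) (\<lambda>r v. ln (sum_coords v)) (last c) (redB B c *v ones)" for n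
  have X: "log_growth (redC C Q rs) (redQ Q) (redB B) (Suc n) c ones = X (d * n)" for n
  proof -
    have "log_growth (redC C Q rs) (redQ Q) (redB B) (Suc n) c ones
       = (step_mean (redC C Q rs) (redQ Q) (\<lambda>c v. redB B c *v v) ^^ n) (\<lambda>r v. ln (sum_coords v)) c (redB B c *v ones)"
      by (rule chain_op_Suc_eq_step_mean[OF redQ_row_sum c])
    moreover have "(\<lambda>c v. redB B c *v v) = fold (\<lambda>r v. B r *v v)" by (intro ext redB_mult_vec)
    ultimately show ?thesis by (simp only: X_def step_mean_redC_funpow[OF c])
  qed
  have lim: "(\<lambda>n. X n / real n) \<longlonglongrightarrow> lam" unfolding X_def
    using redC_D[OF c] pos det by (intro growth pos_mat_redB det_redB_nonzero) auto
  have "filterlim (\<lambda>n. d * n) at_top sequentially"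
    using period_pos by (intro filterlim_subseq strict_monoI) auto
  from filterlim_compose[OF lim this]
  have "(\<lambda>n. X (d * n) / real (d * n) * (real d * (real n / real (Suc n)))) \<longlonglongrightarrow> lam * (real d * 1)"
    by (intro tendsto_mult tendsto_const LIMSEQ_n_over_Suc_n)
  moreover have "\<forall>\<^sub>F n in sequentially. X (d * n) / real (d * n) * (real d * (real n / real (Suc n))) = X (d * n) / real (Suc n)"
    using eventually_gt_at_top[of 0] by eventually_elim (use period_pos in simp)
  ultimately have "(\<lambda>n. X (d * n) / real (Suc n)) \<longlonglongrightarrow> real d * lam"
    by (simp add: filterlim_cong mult.commute)
  then show ?thesis unfolding X[symmetric] by (subst filterlim_sequentially_Suc[symmetric])
qed

end

section \<open>The projective line and the local matrices\<close>

lemma Rep_rp1_of: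
  assumes "v \<noteq> 0"
  shows "Rep_rp1 (rp1_of v) = span {v}"
  unfolding rp1_of_def using assms by (intro Abs_rp1_inverse) (simp add: dim_insert)

lemma rp1_eq_rp1_of: obtains v where "v \<noteq> 0" "l = rp1_of v"
proof -
  have S: "subspace (Rep_rp1 l)" "dim (Rep_rp1 l) = 1" using Rep_rp1[of l] by auto
  then have "\<not> Rep_rp1 l \<subseteq> {0}" by (metis dim_eq_0 zero_neq_one)
  then obtain v where v: "v \<in> Rep_rp1 l" "v \<noteq> 0" by auto
  have "span {v} = Rep_rp1 l"
    using v S by (intro subspace_dim_equal) (auto simp: span_minimal dim_insert)
  then have "l = rp1_of v" unfolding rp1_of_def by (simp add: Rep_rp1_inverse)
  then show thesis using that v by blast
qed

lemma rp1_of_eq_iff: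
  assumes "v \<noteq> 0" "w \<noteq> 0"
  shows "rp1_of v = rp1_of w \<longleftrightarrow> (\<exists>c. c \<noteq> 0 \<and> w = c *\<^sub>R v)"
proof
  assume "rp1_of v = rp1_of w"
  then have "span {v} = span {w}" by (metis Rep_rp1_of assms)
  then have "w \<in> span {v}" by (simp add: span_base)
  then show "\<exists>c. c \<noteq> 0 \<and> w = c *\<^sub>R v" using assms(2) by (auto simp: span_singleton)
next
  assume "\<exists>c. c \<noteq> 0 \<and> w = c *\<^sub>R v"
  then obtain c where "c \<noteq> 0" "w = c *\<^sub>R v" by blast
  then have "w \<in> span {v}" "(1 / c) *\<^sub>R w = v" by (simp_all add: span_scale span_base)
  moreover have "(1 / c) *\<^sub>R w \<in> span {w}" by (intro span_scale span_base) simp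
  ultimately have "span {w} = span {v}" by (simp add: span_eq)
  then show "rp1_of v = rp1_of w" by (simp add: rp1_of_def)
qed

lemma invertible_mult_nonzero:
  fixes G :: "real^2^2"
  assumes "invertible G" "v \<noteq> 0" shows "G *v v \<noteq> 0"
  using assms by (metis invertible_def matrix_vector_mul_assoc matrix_vector_mul_lid matrix_vector_mult_0_right)

lemma proj_act_rp1_of:
  assumes "v \<noteq> 0"
  shows "proj_act G (rp1_of v) = rp1_of (G *v v)"
proof -
  have "(\<lambda>v. G *v v) ` span {v} = span ((\<lambda>v. G *v v) ` {v})"
    by (rule linear_span_image[symmetric]) (rule matrix_vector_mul_linear)
  then show ?thesis unfolding proj_act_def Rep_rp1_of[OF assms] by (simp add: rp1_of_def)
qed

lemma proj_act_mult:
  assumes "invertible H"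
  shows "proj_act (G ** H) l = proj_act G (proj_act H l)"
  by (rule rp1_eq_rp1_of[of l])
     (simp add: proj_act_rp1_of invertible_mult_nonzero assms matrix_vector_mul_assoc)

lemma proj_act_id: "proj_act (mat 1) l = l"
  by (rule rp1_eq_rp1_of[of l]) (simp add: proj_act_rp1_of)

lemma open_proj_act_vimage:
  assumes "invertible G" "open U"
  shows "open (proj_act G -` U)"
proof -
  have nz: "G *v v = 0 \<longleftrightarrow> v = 0" for v
    by (metis matrix_vector_mult_0_right invertible_mult_nonzero[OF assms(1)])
  have "{v. v \<noteq> 0 \<and> rp1_of v \<in> proj_act G -` U} = (\<lambda>v. G *v v) -` {v. v \<noteq> 0 \<and> rp1_of v \<in> U}"
    by (auto simp: proj_act_rp1_of nz)
  moreover have "open ((\<lambda>v. G *v v) -` {v. v \<noteq> 0 \<and> rp1_of v \<in> U})"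
    using assms(2) unfolding open_rp1_def
    by (intro open_vimage) (auto intro: linear_continuous_on matrix_vector_mul_bounded_linear)
  ultimately show ?thesis unfolding open_rp1_def by simp
qed

lemma continuous_proj_act:
  assumes "invertible G"
  shows "continuous_on S (proj_act G)"
  by (rule continuous_on_subset[of UNIV])
     (auto simp: continuous_on_open_vimage open_proj_act_vimage[OF assms])

section \<open>Open intervals and connected components in the projective line\<close>

definition cross2 :: "real^2 \<Rightarrow> real^2 \<Rightarrow> real" where
  "cross2 v w = v $ 1 * w $ 2 - v $ 2 * w $ 1"

definition unit_vec :: "real \<Rightarrow> real^2" where
  "unit_vec \<theta> = vector [cos \<theta>, sin \<theta>]"

lemma unit_vec_nth [simp]: "unit_vec \<theta> $ 1 = cos \<theta>" "unit_vec \<theta> $ 2 = sin \<theta>"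
  by (simp_all add: unit_vec_def vector_2)

lemma unit_vec_nonzero: "unit_vec \<theta> \<noteq> 0"
proof
  assume "unit_vec \<theta> = 0"
  then have "cos \<theta> = 0" "sin \<theta> = 0" by (metis unit_vec_nth zero_index)+
  then show False using sin_cos_squared_add[of \<theta>] by simp
qed

lemma cross2_unit_vec: "cross2 (unit_vec a) (r *\<^sub>R unit_vec b) = r * sin (b - a)"
   "cross2 (r *\<^sub>R unit_vec a) (unit_vec b) = r * sin (b - a)"
  by (simp_all add: cross2_def sin_diff algebra_simps)

lemma polar_form:
  fixes v :: "real^2"
  obtains r \<theta> where "a \<le> \<theta>" "\<theta> < a + 2 * pi" "v = r *\<^sub>R unit_vec \<theta>" "0 \<le> r"
proof -
  define r where "r = norm v"
  have n: "(v $ 1)\<^sup>2 + (v $ 2)\<^sup>2 = r\<^sup>2"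
    unfolding r_def power2_norm_eq_inner by (simp add: inner_vec_def sum_2 power2_eq_square)
  show thesis
  proof (cases "r = 0")
    case True
    then have "v = 0 *\<^sub>R unit_vec a" by (simp add: r_def)
    then show ?thesis by (intro that[of a 0]) auto
  next
    case False
    then have r: "0 < r" by (simp add: r_def)
    have "(v $ 1 / r)\<^sup>2 + (v $ 2 / r)\<^sup>2 = 1"
      using n r by (simp add: power_divide flip: add_divide_distrib)
    then obtain t where t: "v $ 1 / r = cos t" "v $ 2 / r = sin t" by (rule sincos_total_2pi) 
    define k where "k = \<lfloor>(t - a) / (2 * pi)\<rfloor>"
    define \<theta> where "\<theta> = t - of_int k * (2 * pi)"
    have "of_int k \<le> (t - a) / (2 * pi)" "(t - a) / (2 * pi) < of_int k + 1"
      unfolding k_def by linarith+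
    then have "a \<le> \<theta>" "\<theta> < a + 2 * pi" by (auto simp: \<theta>_def field_simps)
    moreover have "cos \<theta> = cos t" "sin \<theta> = sin t"
      unfolding \<theta>_def cos_diff sin_diff using cos_int_2pin[of k] sin_int_2pin[of k] by (auto simp: mult_ac)
    then have "v = r *\<^sub>R unit_vec \<theta>" using t r by (simp add: vec_eq_iff forall_2 field_simps)
    ultimately show ?thesis using r by (intro that[of \<theta> r]) auto
  qed
qed

lemma rp1_open_interval_open:
  assumes "rp1_open_interval I"
  shows "open I"
proof -
  obtain a b where ab: "a < b" "b - a < pi" "I = (\<lambda>\<theta>. rp1_of (unit_vec \<theta>)) ` {a<..<b}"
    using assms unfolding rp1_open_interval_def unit_vec_def by blast
  \<comment> \<open>The vectors over an interval form a double cone. The product of the two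
    determinants is quadratic in \<open>v\<close>, hence blind to the sign of \<open>v\<close>, and
    it describes this cone by a single strict polynomial inequality.\<close>
  have "{v. v \<noteq> 0 \<and> rp1_of v \<in> I} = {v. 0 < cross2 (unit_vec a) v * cross2 v (unit_vec b)}" (is "?L = ?R")
  proof (intro subset_antisym subsetI)
    fix v assume "v \<in> ?L"
    then obtain t where t: "t \<in> {a<..<b}" "v \<noteq> 0" "rp1_of (unit_vec t) = rp1_of v" using ab by auto
    then obtain c where c: "c \<noteq> 0" "v = c *\<^sub>R unit_vec t" using rp1_of_eq_iff unit_vec_nonzero by metis
    have "0 < sin (t - a)" "0 < sin (b - t)" using t ab by (auto intro!: sin_gt_zero)
    moreover have "0 < c * c" using c(1) by (metis not_square_less_zero linorder_neqE_linordered_idom mult_eq_0_iff)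
    ultimately have "0 < (c * c) * (sin (t - a) * sin (b - t))" by simp
    then show "v \<in> ?R" unfolding c(2) by (simp add: cross2_unit_vec mult_ac)
  next
    fix v assume v: "v \<in> ?R"
    obtain r t where t: "a \<le> t" "t < a + 2 * pi" "v = r *\<^sub>R unit_vec t" "0 \<le> r" by (rule polar_form)
    have "0 < r\<^sup>2 * (sin (t - a) * sin (b - t))"
      using v unfolding t(3) by (simp add: cross2_unit_vec power2_eq_square mult_ac)
    then have r: "r \<noteq> 0" and s: "0 < sin (t - a) * sin (b - t)" by (auto simp: zero_less_mult_iff)
    have v0: "v \<noteq> 0" using r t(3) unit_vec_nonzero by simp
    show "v \<in> ?L"
    proof (cases "t - a < pi")
      case True
      have "0 \<le> sin (t - a)" using t True by (intro sin_ge_zero) auto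
      then have "0 < sin (b - t)" using s by (auto simp: zero_less_mult_iff)
      then have "t < b" using sin_ge_zero[of "t - b"] t ab True sin_minus[of "t - b"] by (cases "t < b") auto
      moreover have "a \<noteq> t" using s by auto
      ultimately have "t \<in> {a<..<b}" using t by auto
      moreover have "rp1_of v = rp1_of (unit_vec t)"
        using rp1_of_eq_iff[OF unit_vec_nonzero v0] r t(3) by metis
      ultimately show ?thesis using v0 ab(3) by auto
    next
      case False
      \<comment> \<open>A vector in the opposite half of the double cone spans the same line as its
        negative, whose angle is \<open>t - pi\<close>.\<close>
      define u where "u = t - pi"
      have su: "sin (t - a) = - sin (u - a)" "sin (b - t) = - sin (b - u)"
        using sin_periodic_pi[of "u - a"] sin_periodic_pi[of "b - t"] by (auto simp: u_def algebra_simps)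
      have u: "a \<le> u" "u < a + pi" using t False by (auto simp: u_def)
      have s': "0 < sin (u - a) * sin (b - u)" using s unfolding su by simp
      have "0 \<le> sin (u - a)" using u by (intro sin_ge_zero) auto
      then have "0 < sin (b - u)" using s' by (auto simp: zero_less_mult_iff)
      then have "u < b" using sin_ge_zero[of "u - b"] u ab sin_minus[of "u - b"] by (cases "u < b") auto
      moreover have "a \<noteq> u" using s' by auto
      ultimately have "u \<in> {a<..<b}" using u by auto
      moreover have "unit_vec t = - unit_vec u" by (simp add: u_def vec_eq_iff forall_2)
      then have "v = (- r) *\<^sub>R unit_vec u" using t(3) by simp
      then have "rp1_of v = rp1_of (unit_vec u)"
        using rp1_of_eq_iff[OF unit_vec_nonzero v0] r by (metis neg_equal_0_iff_equal)
      ultimately show ?thesis using v0 ab(3) by auto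
    qed
  qed
  moreover have "open ?R"
    unfolding cross2_def by (intro open_Collect_less continuous_intros)
  ultimately show ?thesis unfolding open_rp1_def by simp
qed

lemma rp1_open_interval_connected:
  assumes "rp1_open_interval I"
  shows "connected I"
proof -
  obtain a b where ab: "a < b" "I = (\<lambda>\<theta>. rp1_of (unit_vec \<theta>)) ` {a<..<b}"
    using assms unfolding rp1_open_interval_def unit_vec_def by blast
  have c: "continuous_on UNIV unit_vec"
  proof -
    have "unit_vec = (\<lambda>\<theta>. cos \<theta> *\<^sub>R axis 1 1 + sin \<theta> *\<^sub>R axis 2 1)"
      by (simp add: fun_eq_iff vec_eq_iff forall_2 axis_def)
    then show ?thesis by (rule ssubst) (intro continuous_intros)
  qed
  have r: "continuous_on UNIV (\<lambda>\<theta>. rp1_of (unit_vec \<theta>))"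
  proof (subst continuous_on_open_vimage, simp, intro allI impI)
    fix U :: "rp1 set" assume "open U"
    then have "open (unit_vec -` {v. v \<noteq> 0 \<and> rp1_of v \<in> U})"
      unfolding open_rp1_def using c by (intro open_vimage)
    moreover have "unit_vec -` {v. v \<noteq> 0 \<and> rp1_of v \<in> U} = (\<lambda>\<theta>. rp1_of (unit_vec \<theta>)) -` U \<inter> UNIV"
      using unit_vec_nonzero by auto
    ultimately show "open ((\<lambda>\<theta>. rp1_of (unit_vec \<theta>)) -` U \<inter> UNIV)" by simp
  qed
  show ?thesis unfolding ab(2)
    by (rule connected_continuous_image[OF continuous_on_subset[OF r]]) auto
qed

text \<open>Intervals are open and connected, so an interval that meets a component is contained in
  it.\<close>

lemma open_comps:
  assumes F: "\<And>I. I \<in> F \<Longrightarrow> rp1_open_interval I" and K: "K \<in> comps (\<Union>F)"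
  shows "open K"
proof (subst open_subopen, intro ballI)
  fix z assume z: "z \<in> K"
  obtain x where x: "K = connected_component_set (\<Union>F) x" using K by (auto simp: comps_def)
  then have Kz: "K = connected_component_set (\<Union>F) z" using z connected_component_eq by metis
  have "z \<in> \<Union>F" using z x connected_component_subset by blast
  then obtain I where I: "I \<in> F" "z \<in> I" by blast
  then have "I \<subseteq> K" unfolding Kz using rp1_open_interval_connected[OF F]
    by (intro connected_component_maximal) auto
  then show "\<exists>T. open T \<and> z \<in> T \<and> T \<subseteq> K" using I rp1_open_interval_open[OF F] by blast
qed

section \<open>Positivity of the local matrices\<close>

lemma rp1_of_in_Vnonneg_iff:
  assumes "v \<noteq> 0"
  shows "rp1_of v \<in> Vnonneg \<longleftrightarrow> 0 \<le> v $ 1 * v $ 2"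
proof
  assume "rp1_of v \<in> Vnonneg"
  then obtain w where w: "w \<noteq> 0" "\<forall>i. 0 \<le> w $ i" "rp1_of w = rp1_of v" by (auto simp: Vnonneg_def)
  then obtain c where "v = c *\<^sub>R w" using rp1_of_eq_iff assms by metis
  then have "v $ 1 * v $ 2 = (c * c) * (w $ 1 * w $ 2)" by simp
  then show "0 \<le> v $ 1 * v $ 2" using w(2) by (metis mult_nonneg_nonneg zero_le_square)
next
  assume v: "0 \<le> v $ 1 * v $ 2"
  have "\<exists>c. c \<noteq> 0 \<and> v = c *\<^sub>R (- v)" by (rule exI[of _ "- 1"]) simp
  then have "rp1_of (- v) = rp1_of v" using rp1_of_eq_iff[of "- v" v] assms by simp
  moreover have "(\<forall>i. 0 \<le> v $ i) \<or> (\<forall>i. 0 \<le> (- v) $ i)"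
    using v by (auto simp: forall_2 zero_le_mult_iff)
  moreover have "rp1_of u \<in> Vnonneg" if "u \<noteq> 0" "\<forall>i. 0 \<le> u $ i" for u
    using that by (auto simp: Vnonneg_def)
  ultimately show "rp1_of v \<in> Vnonneg" using assms by (metis neg_equal_0_iff_equal)
qed

lemma open_subset_Vnonneg:
  assumes "open U" "U \<subseteq> Vnonneg" "rp1_of v \<in> U" "v \<noteq> 0"
  shows "0 < v $ 1 * v $ 2"
proof (rule ccontr)
  assume "\<not> 0 < v $ 1 * v $ 2"
  moreover have "0 \<le> v $ 1 * v $ 2" using rp1_of_in_Vnonneg_iff assms by blast
  ultimately have z: "v $ 1 * v $ 2 = 0" by simp
  define s where "s = v $ 1 + v $ 2"
  have s: "s \<noteq> 0" using z assms(4) by (auto simp: s_def vec_eq_iff forall_2)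
  \<comment> \<open>If one coordinate of \<open>v\<close> is zero, the product of the coordinates
    along this segment equals \<open>- t * s\<^sup>2\<close>. So arbitrarily small
    \<open>t > 0\<close> leave the quadrant, which an open neighbourhood inside it forbids.\<close>
  define w where "w t = v - t *\<^sub>R (vector [v $ 2, v $ 1] :: real^2)" for t
  have "open {u. u \<noteq> 0 \<and> rp1_of u \<in> U}" using assms(1) by (simp add: open_rp1_def)
  moreover have "continuous_on UNIV w" unfolding w_def by (intro continuous_intros)
  ultimately have "open (w -` {u. u \<noteq> 0 \<and> rp1_of u \<in> U})" by (rule open_vimage)
  moreover have "0 \<in> w -` {u. u \<noteq> 0 \<and> rp1_of u \<in> U}" using assms by (simp add: w_def)
  ultimately obtain e where e: "0 < e" "ball 0 e \<subseteq> w -` {u. u \<noteq> 0 \<and> rp1_of u \<in> U}"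
    by (rule openE)
  then have "e / 2 \<in> w -` {u. u \<noteq> 0 \<and> rp1_of u \<in> U}" by (intro subsetD[OF e(2)]) (simp add: dist_real_def)
  then have "0 \<le> w (e / 2) $ 1 * w (e / 2) $ 2" using assms(2) rp1_of_in_Vnonneg_iff by blast
  also have "w (e / 2) $ 1 * w (e / 2) $ 2 = - (e / 2) * s\<^sup>2 + v $ 1 * v $ 2 * (1 + e / 2) ^ 2 "
    by (simp add: w_def vector_2 s_def power2_eq_square field_simps)
  also have "\<dots> < 0" unfolding z using s e(1) by simp
  finally show False by simp
qed

lemma matrix_definite_sign:
  fixes G :: "real^2^2"
  assumes "\<And>v. v \<noteq> 0 \<Longrightarrow> \<forall>i. 0 \<le> v $ i \<Longrightarrow> 0 < (G *v v) $ 1 * (G *v v) $ 2"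
  shows "pos_mat G \<or> pos_mat (- G)"
proof -
  have 1: "0 < G $ 1 $ 1 * G $ 2 $ 1"
    using assms[of "vector [1, 0]"] by (simp add: mult_vec_nth_2 vector_2 forall_2 vec_eq_iff)
  have 2: "0 < G $ 1 $ 2 * G $ 2 $ 2"
    using assms[of "vector [0, 1]"] by (simp add: mult_vec_nth_2 vector_2 forall_2 vec_eq_iff)
  \<comment> \<open>For opposite signs in the first row this nonnegative vector is annihilated by
    that row, so the product of the image coordinates would be zero.\<close>
  have 3: "False" if "G $ 1 $ 1 * G $ 1 $ 2 < 0"
    using assms[of "vector [\<bar>G $ 1 $ 2\<bar>, \<bar>G $ 1 $ 1\<bar>]"] that
    by (auto simp: mult_vec_nth_2 vector_2 forall_2 vec_eq_iff mult_less_0_iff)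
  show ?thesis using 1 2 3 unfolding pos_mat_def forall_2
    by (auto simp: zero_less_mult_iff mult_less_0_iff)
qed

text \<open>The image of \<open>closure K\<close> is connected and contained in \<open>M j\<close>,
  hence in exactly one component; so the \<open>THE\<close> in \<open>beta_br\<close> is well
  defined.\<close>

lemma beta_br_in_comps:
  assumes mc: "multicone P A M" and GL: "invertible (A j)" and "0 < P i j" and K: "K \<in> comps (M i)"
  shows "beta_br A M i K j \<in> comps (M j)" "proj_act (A j) ` closure K \<subseteq> beta_br A M i K j"
proof -
  let ?S = "proj_act (A j) ` closure K"
  obtain x where x: "K = connected_component_set (M i) x" "x \<in> M i" using K by (auto simp: comps_def)
  then have "x \<in> closure K" using closure_subset by fastforce
  have conn: "connected ?S" unfolding x(1)
    by (intro connected_continuous_image continuous_proj_act[OF GL] connected_imp_connected_closure connected_connected_component)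
  have "?S \<subseteq> closure (proj_act (A j) ` M i)"
  proof (rule image_closure_subset[OF continuous_proj_act[OF GL]])
    show "proj_act (A j) ` K \<subseteq> closure (proj_act (A j) ` M i)"
      unfolding x(1) by (intro order_trans[OF image_mono closure_subset] connected_component_subset)
  qed (rule closed_closure)
  also have "\<dots> \<subseteq> M j" using mc assms(3) by (auto simp: multicone_def)
  finally have sub: "?S \<subseteq> M j" .
  define y where "y = proj_act (A j) x"
  have y: "y \<in> ?S" using \<open>x \<in> closure K\<close> by (simp add: y_def)
  have "\<exists>!K'. K' \<in> comps (M j) \<and> ?S \<subseteq> K'"
  proof (rule ex1I[of _ "connected_component_set (M j) y"])
    show "connected_component_set (M j) y \<in> comps (M j) \<and> ?S \<subseteq> connected_component_set (M j) y"
      using y sub conn connected_component_maximal[OF y conn sub] by (auto simp: comps_def)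
    fix K' assume K': "K' \<in> comps (M j) \<and> ?S \<subseteq> K'"
    then obtain z where "K' = connected_component_set (M j) z" by (auto simp: comps_def)
    then show "K' = connected_component_set (M j) y" using K' y connected_component_eq by blast
  qed
  from theI'[OF this] show "beta_br A M i K j \<in> comps (M j)" "?S \<subseteq> beta_br A M i K j"
    unfolding beta_br_def by auto
qed

lemma Rset_D:
  assumes mc: "multicone P A M" and GL: "\<forall>i. invertible (A i)" and "r \<in> Rset P A M"
  shows "0 < P (fst (fst r)) (fst (snd r))" "snd (fst r) \<in> comps (M (fst (fst r)))"
    "snd (snd r) \<in> comps (M (fst (snd r)))"
    "proj_act (A (fst (snd r))) ` closure (snd (fst r)) \<subseteq> snd (snd r)"
proof -
  obtain i K j K' where r: "r = ((i, K), (j, K'))" by (metis surj_pair)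
  then have *: "0 < P i j" "K \<in> comps (M i)" "K' = beta_br A M i K j"
    using assms(3) by (auto simp: Rset_def)
  show "0 < P (fst (fst r)) (fst (snd r))" "snd (fst r) \<in> comps (M (fst (fst r)))"
    "snd (snd r) \<in> comps (M (fst (snd r)))"
    "proj_act (A (fst (snd r))) ` closure (snd (fst r)) \<subseteq> snd (snd r)"
    unfolding r fst_conv snd_conv using * beta_br_in_comps[OF mc GL[rule_format] *(1,2)] by simp_all
qed

lemma matrix_inv_inverse:
  fixes G :: "real^'n^'n"
  assumes "invertible G"
  shows "G ** matrix_inv G = mat 1" "matrix_inv G ** G = mat 1" "invertible (matrix_inv G)"
proof -
  show *: "G ** matrix_inv G = mat 1" "matrix_inv G ** G = mat 1"
    using someI_ex[OF assms[unfolded invertible_def]] unfolding matrix_inv_def by auto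
  then show "invertible (matrix_inv G)" unfolding invertible_def by blast
qed

text \<open>The map \<open>A j\<close> sends \<open>closure K\<close> into the open component
  \<open>K'\<close> itself, not merely into its closure. Pulled back by the chart, the image of the
  closed quadrant lies in an open subset of the quadrant, which forces strict positivity up to a
  common sign.\<close>

lemma pos_mat_local_matrix:
  assumes mc: "multicone P A M" and GL: "\<forall>i. invertible (A i)" and ch: "local_charts M L"
    and r: "r \<in> Rset P A M"
  defines "G \<equiv> matrix_inv (L (snd r)) ** A (fst (snd r)) ** L (fst r)"
  shows "pos_mat G \<or> pos_mat (- G)"
proof (rule matrix_definite_sign)
  fix v :: "real^2" assume v: "v \<noteq> 0" "\<forall>i. 0 \<le> v $ i"
  obtain i K j K' where rr: "r = ((i, K), (j, K'))" by (metis surj_pair)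
  note R = Rset_D[OF mc GL r, unfolded rr, simplified]
  have L: "invertible (L (i, K))" "proj_act (L (i, K)) ` Vnonneg = closure K"
      "invertible (L (j, K'))" "proj_act (L (j, K')) ` Vnonneg = closure K'"
    using ch R by (auto simp: local_charts_def)
  have inv: "matrix_inv (L (j, K')) ** L (j, K') = mat 1" "invertible (matrix_inv (L (j, K')))"
    using matrix_inv_inverse[OF L(3)] by auto
  have Ginv: "invertible G" unfolding G_def rr using L(1) inv(2) GL by (simp add: invertible_mult)
  define U where "U = proj_act (L (j, K')) -` K'"
  obtain F where F: "\<And>I. I \<in> F \<Longrightarrow> rp1_open_interval I" "M j = \<Union>F"
    using mc unfolding multicone_def by metis
  have "open U" unfolding U_def
    using R(3) F by (intro open_proj_act_vimage L(3)) (metis open_comps)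
  moreover have "U \<subseteq> Vnonneg"
  proof
    fix l assume "l \<in> U"
    then have "proj_act (L (j, K')) l \<in> proj_act (L (j, K')) ` Vnonneg"
      unfolding L(4) U_def using closure_subset by auto
    then obtain l' where l': "l' \<in> Vnonneg" "proj_act (L (j, K')) l = proj_act (L (j, K')) l'" by blast
    have "l = l'" using l'(2) proj_act_mult[OF L(3), of "matrix_inv (L (j, K'))"] inv(1) proj_act_id by metis
    then show "l \<in> Vnonneg" using l' by simp
  qed
  moreover have "rp1_of (G *v v) \<in> U"
  proof -
    have LG: "L (j, K') ** G = A j ** L (i, K)"
      unfolding G_def rr using matrix_inv_inverse(1)[OF L(3)] by (simp add: matrix_mul_assoc)
    have "rp1_of v \<in> Vnonneg" using v by (auto simp: Vnonneg_def)
    then have "proj_act (A j) (proj_act (L (i, K)) (rp1_of v)) \<in> K'" using L(2) R(4) by blast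
    then show ?thesis unfolding U_def vimage_eq proj_act_rp1_of[OF v(1), symmetric]
      by (simp add: proj_act_mult[OF Ginv, symmetric] LG proj_act_mult[OF L(1)])
  qed
  ultimately show "0 < (G *v v) $ 1 * (G *v v) $ 2"
    by (rule open_subset_Vnonneg) (rule invertible_mult_nonzero[OF Ginv v(1)])
qed

lemma Bloc_properties:
  assumes mc: "multicone P A M" and GL: "\<forall>i. invertible (A i)" and ch: "local_charts M L"
    and r: "r \<in> Rset P A M"
  shows "pos_mat (Bloc A L r)" "det (Bloc A L r) \<noteq> 0" "invertible (L (snd r))"
    "\<exists>\<sigma>. (\<sigma> = 1 \<or> \<sigma> = - 1) \<and> A (fst (snd r)) ** L (fst r) = \<sigma> *\<^sub>R (L (snd r) ** Bloc A L r)"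
proof -
  define G where "G = matrix_inv (L (snd r)) ** A (fst (snd r)) ** L (fst r)"
  have B: "Bloc A L r = (if pos_mat G then G else - G)"
    by (simp add: Bloc_def G_def pos_mat_def Let_def)
  show "pos_mat (Bloc A L r)" using pos_mat_local_matrix[OF mc GL ch r] unfolding B G_def by auto
  note R = Rset_D[OF mc GL r]
  have L: "invertible (L (fst r))" "invertible (L (snd r))"
    using ch R unfolding local_charts_def by (metis prod.collapse)+
  then show "invertible (L (snd r))" by simp
  have "invertible (matrix_inv (L (snd r)))"
    by (rule matrix_inv_inverse(3)[OF L(2)])
  then have "invertible G" unfolding G_def using L GL by (simp add: invertible_mult)
  then have "det G \<noteq> 0" by (simp add: invertible_det_nz)
  moreover have "det (- G) = det G" by (simp add: det_2)
  ultimately show "det (Bloc A L r) \<noteq> 0" by (simp add: B)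
  have LG: "L (snd r) ** G = A (fst (snd r)) ** L (fst r)"
    unfolding G_def using matrix_inv_inverse(1)[OF L(2)] by (simp add: matrix_mul_assoc)
  moreover have "L (snd r) ** (- G) = - (L (snd r) ** G)"
    by (simp add: matrix_matrix_mult_def vec_eq_iff sum_negf)
  ultimately show "\<exists>\<sigma>. (\<sigma> = 1 \<or> \<sigma> = - 1) \<and> A (fst (snd r)) ** L (fst r) = \<sigma> *\<^sub>R (L (snd r) ** Bloc A L r)"
    unfolding B by (cases "pos_mat G") (auto intro: exI[of _ 1] exI[of _ "-1"])
qed

section \<open>Comparison with the base chain\<close>

lemma matrix_sandwich_norm_bounds:
  fixes L H :: "real^2^2"
  assumes "invertible L" "invertible H"
  shows "\<exists>c\<ge>1. \<forall>N. norm (L ** N ** H) \<le> c * norm N \<and> norm N \<le> c * norm (L ** N ** H)"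
proof -
  have "\<exists>c>0. \<forall>N. norm (L ** N ** H) \<le> c * norm N" for L H :: "real^2^2"
  proof -
    have "linear (\<lambda>N. L ** N ** H)"
      by (rule linearI) (simp_all add: vec_eq_iff matrix_matrix_mult_def sum_2 algebra_simps)
    from linear_bounded_pos[OF this] show ?thesis by blast
  qed
  then obtain c1 c2 where c: "\<And>N. norm (L ** N ** H) \<le> c1 * norm N"
      "\<And>N. norm (matrix_inv L ** N ** matrix_inv H) \<le> c2 * norm N" by metis
  define c where "c = max 1 (max c1 c2)"
  have le: "c1 * norm N \<le> c * norm N" "c2 * norm N \<le> c * norm N" for N :: "real^2^2"
    by (auto simp: c_def intro: mult_right_mono)
  have "matrix_inv L ** (L ** N ** H) ** matrix_inv H = N" for N
    using matrix_inv_inverse[OF assms(1)] matrix_inv_inverse[OF assms(2)]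
    by (metis matrix_mul_assoc matrix_mul_lid matrix_mul_rid)
  then have "norm N \<le> c * norm (L ** N ** H)" for N
    using order_trans[OF c(2)[of "L ** N ** H"] le(2)] by simp
  moreover have "norm (L ** N ** H) \<le> c * norm N" for N using order_trans[OF c(1) le(1)] .
  ultimately show ?thesis by (intro exI[of _ c]) (auto simp: c_def)
qed

lemma ln_diff_bound:
  fixes x y c :: real
  assumes "0 < x" "0 < y" "x \<le> c * y" "y \<le> c * x"
  shows "\<bar>ln x - ln y\<bar> \<le> ln c"
proof -
  have c: "0 < c" using assms by (metis less_le_trans zero_less_mult_pos2)
  have "ln x \<le> ln (c * y)" "ln y \<le> ln (c * x)" using assms by auto
  then show ?thesis using assms c by (simp add: ln_mult)
qed

text \<open>The coordinate sum of \<open>N *v ones\<close> is the sum of all four entries of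
  \<open>N\<close>, and \<open>norm\<close> is the Euclidean norm of the entries; hence the constant
  \<open>4\<close>.\<close>

lemma sum_coords_norm_bounds:
  assumes "pos_mat N"
  shows "0 < sum_coords (N *v ones)" "norm N \<le> sum_coords (N *v ones)" "sum_coords (N *v ones) \<le> 4 * norm N"
proof -
  note p = pos_matD[OF assms]
  have S: "sum_coords (N *v ones) = N$1$1 + N$1$2 + N$2$1 + N$2$2"
    by (simp add: sum_coords_def mult_vec_nth_2 ones_def vector_2)
  then show "0 < sum_coords (N *v ones)" using p by (simp add: add_pos_pos)
  have "norm N \<le> norm (N $ 1) + norm (N $ 2)"
    unfolding norm_vec_def[of N] using L2_set_le_sum[of UNIV "\<lambda>i. norm (N $ i)"] by (simp add: sum_2)
  moreover have "norm (N $ i) \<le> N $ i $ 1 + N $ i $ 2" for i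
    using norm_le_l1_cart[of "N $ i"] p by (simp add: sum_2 less_imp_le)
  from this[of 1] this[of 2] have "norm (N $ 1) + norm (N $ 2) \<le> sum_coords (N *v ones)"
    unfolding S by linarith
  ultimately show "norm N \<le> sum_coords (N *v ones)" by linarith
  have "N $ i $ j \<le> norm N" for i j
    using component_le_norm_cart[of "N $ i" j] Finite_Cartesian_Product.norm_nth_le[of N i] p[of i j] by simp
  from this[of 1 1] this[of 1 2] this[of 2 1] this[of 2 2]
  show "sum_coords (N *v ones) \<le> 4 * norm N" unfolding S by linarith
qed

lemma log_norm_comparison:
  fixes L H :: "real^2^2"
  assumes "invertible L" "invertible H"
  obtains c where "0 \<le> c"
    "\<And>N. pos_mat N \<Longrightarrow> \<bar>ln (sum_coords (N *v ones)) - ln (norm (L ** N ** H))\<bar> \<le> c"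
proof -
  obtain c where c: "1 \<le> c" "\<And>N. norm (L ** N ** H) \<le> c * norm N" "\<And>N. norm N \<le> c * norm (L ** N ** H)"
    using matrix_sandwich_norm_bounds[OF assms] by blast
  have "\<bar>ln (sum_coords (N *v ones)) - ln (norm (L ** N ** H))\<bar> \<le> ln (4 * c)" if N: "pos_mat N" for N
  proof (rule ln_diff_bound)
    note S = sum_coords_norm_bounds[OF N]
    show "0 < sum_coords (N *v ones)" by (rule S)
    have "0 < norm N" using pos_matD[OF N, of 1 1] by auto
    then show "0 < norm (L ** N ** H)" using c(3)[of N] by (cases "L ** N ** H = 0") auto
    show "sum_coords (N *v ones) \<le> 4 * c * norm (L ** N ** H)" using S(3) c(3)[of N] by simp
    have "norm (L ** N ** H) \<le> c * norm N" by (rule c)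
    also have "\<dots> \<le> c * sum_coords (N *v ones)" using c S by (intro mult_left_mono) auto
    also have "\<dots> \<le> 4 * c * sum_coords (N *v ones)" using c S(1) by simp
    finally show "norm (L ** N ** H) \<le> 4 * c * sum_coords (N *v ones)" .
  qed
  then show thesis using c(1) by (intro that[of "ln (4 * c)"]) auto
qed

lemma matrix_mult_scaleR_right: "M ** (c *\<^sub>R N) = c *\<^sub>R (M ** N)" for M N :: "real^2^2"
  by (simp add: vec_eq_iff matrix_matrix_mult_def sum_2 algebra_simps)

definition next_state ::
  "('x \<Rightarrow> real^2^2) \<Rightarrow> ('x \<Rightarrow> rp1 set) \<Rightarrow> 'x rstate \<Rightarrow> 'x \<Rightarrow> 'x rstate" where
  "next_state A M r j = (snd r, (j, beta_br A M (fst (snd r)) (snd (snd r)) j))"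

context
  fixes P :: "'x::finite \<Rightarrow> 'x \<Rightarrow> real" and A M L C
  assumes stoch: "row_stochastic P" and GL: "\<forall>i. invertible (A i)" and mc: "multicone P A M"
    and ch: "local_charts M L" and rec: "recurrent_class P A M C"
begin

lemma C_subset: "r \<in> C \<Longrightarrow> r \<in> Rset P A M"
  using rec by (auto simp: recurrent_class_def)

text \<open>Over an infinite \<open>C\<close> the sums in \<^const>\<open>rpow\<close> would vanish, and no state would return to itself.\<close>

lemma finite_recurrent_class: "finite C"
proof (rule ccontr)
  assume inf: "infinite C"
  then obtain r where "r \<in> C" using rec by (auto simp: recurrent_class_def)
  then obtain n where n: "n \<ge> 1" "0 < rpow C (Qmat P) n r r" using rec unfolding recurrent_class_def by blast
  then show False using inf by (cases n) auto
qed

lemma next_state_in_class: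
  assumes "r \<in> C" "0 < P (fst (snd r)) j"
  shows "next_state A M r j \<in> C"
proof -
  have "snd (snd r) \<in> comps (M (fst (snd r)))" using Rset_D(3)[OF mc GL C_subset[OF assms(1)]] .
  then have "next_state A M r j \<in> Rset P A M"
    using assms(2) by (cases r) (auto simp: Rset_def next_state_def)
  moreover have "0 < Qmat P r (next_state A M r j)" using assms(2) by (simp add: Qmat_def next_state_def)
  ultimately show ?thesis using rec assms(1) unfolding recurrent_class_def by blast
qed

text \<open>A successor of \<open>r\<close> must begin with \<open>snd r\<close>, and membership in
  \<open>Rset\<close> fixes its new component as \<open>beta_br\<close>. Only the symbol
  \<open>j\<close> is free, so a step of the class is a step of the base chain.\<close>

lemma Qmat_sum:
  assumes "r \<in> C"
  shows "(\<Sum>r'\<in>C. Qmat P r r' * g r') = (\<Sum>j\<in>UNIV. P (fst (snd r)) j * g (next_state A M r j))"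
proof -
  let ?J = "{j. 0 < P (fst (snd r)) j}"
  have P0: "0 \<le> P i j" for i j using stoch by (simp add: row_stochastic_def)
  have *: "r' \<in> next_state A M r ` ?J" if r': "r' \<in> C" "Qmat P r r' \<noteq> 0" for r'
  proof -
    have s: "snd r = fst r'" "0 < P (fst (snd r)) (fst (snd r'))"
      using r'(2) P0[of "fst (snd r)"] by (auto simp: Qmat_def less_le split: if_splits)
    have "snd (snd r') = beta_br A M (fst (fst r')) (snd (fst r')) (fst (snd r'))"
      using C_subset[OF r'(1)] by (auto simp: Rset_def)
    then have "r' = next_state A M r (fst (snd r'))" using s(1) by (simp add: next_state_def prod_eq_iff)
    then show ?thesis using s(2) by blast
  qed
  have "(\<Sum>r'\<in>C. Qmat P r r' * g r') = (\<Sum>r'\<in>next_state A M r ` ?J. Qmat P r r' * g r')"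
    using * next_state_in_class[OF assms] by (intro sum.mono_neutral_right finite_recurrent_class) auto
  also have "\<dots> = (\<Sum>j\<in>?J. Qmat P r (next_state A M r j) * g (next_state A M r j))"
    by (subst sum.reindex) (auto simp: inj_on_def next_state_def)
  also have "\<dots> = (\<Sum>j\<in>?J. P (fst (snd r)) j * g (next_state A M r j))"
    by (intro sum.cong) (auto simp: Qmat_def next_state_def)
  also have "\<dots> = (\<Sum>j\<in>UNIV. P (fst (snd r)) j * g (next_state A M r j))"
    using P0 by (intro sum.mono_neutral_left) (auto simp: less_le)
  finally show ?thesis .
qed

lemma recurrent_chain_Qmat:
  assumes "rs \<in> C"
  shows "recurrent_chain C (Qmat P) rs"
proof
  show "0 \<le> Qmat P r s" for r s using stoch by (simp add: Qmat_def row_stochastic_def)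
  show "(\<Sum>s\<in>C. Qmat P r s) = 1" if "r \<in> C" for r
    using Qmat_sum[OF that, of "\<lambda>_. 1"] stoch by (simp add: row_stochastic_def)
  show "\<exists>n\<ge>1. 0 < rpow C (Qmat P) n rs rs" using rec assms by (auto simp: recurrent_class_def)
qed (use assms finite_recurrent_class in auto)

text \<open>The relation between \<open>G\<close> and \<open>N\<close> is preserved by every step:
  \<open>A j\<close> moves past the chart and becomes a local matrix, up to a sign, while
  \<open>H\<close> stays on the right. The two logarithms are compared only at the end of each path,
  so the error does not accumulate with \<open>n\<close>.\<close>

lemma local_global_comparison:
  fixes H :: "real^2^2"
  assumes c: "\<And>r N. r \<in> C \<Longrightarrow> pos_mat N \<Longrightarrow>
      \<bar>ln (sum_coords (N *v ones)) - ln (norm (L (snd r) ** N ** H))\<bar> \<le> c"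
    and "r \<in> C" "pos_mat N" "\<sigma> = 1 \<or> \<sigma> = - 1" "G = \<sigma> *\<^sub>R (L (snd r) ** N ** H)"
  shows "\<bar>(step_mean C (Qmat P) (\<lambda>r v. Bloc A L r *v v) ^^ n) (\<lambda>r v. ln (sum_coords v)) r (N *v ones)
      - (step_mean UNIV P (\<lambda>j G. A j ** G) ^^ n) (\<lambda>j G. ln (norm G)) (fst (snd r)) G\<bar> \<le> c"
  using assms(2-)
proof (induction n arbitrary: r N \<sigma> G)
  case 0
  have "norm G = norm (L (snd r) ** N ** H)" using 0 by auto
  then show ?case using c[OF 0(1,2)] by simp
next
  case (Suc n)
  let ?X = "\<lambda>n. (step_mean C (Qmat P) (\<lambda>r v. Bloc A L r *v v) ^^ n) (\<lambda>r v. ln (sum_coords v))"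
  let ?Y = "\<lambda>n. (step_mean UNIV P (\<lambda>j G. A j ** G) ^^ n) (\<lambda>j G. ln (norm G))"
  have P: "\<And>i j. 0 \<le> P i j" "\<And>i. (\<Sum>j\<in>UNIV. P i j) = 1" using stoch by (auto simp: row_stochastic_def)
  have bound: "\<bar>?X n (next_state A M r j) (Bloc A L (next_state A M r j) *v (N *v ones)) - ?Y n j (A j ** G)\<bar> \<le> c"
    if j: "0 < P (fst (snd r)) j" for j
  proof -
    define r' where "r' = next_state A M r j"
    have r': "r' \<in> C" "fst r' = snd r" "fst (snd r') = j"
      using next_state_in_class[OF Suc.prems(1) j] by (auto simp: r'_def next_state_def)
    note Bp = Bloc_properties[OF mc GL ch C_subset[OF r'(1)]]
    obtain \<tau> where \<tau>: "\<tau> = 1 \<or> \<tau> = - 1" "A j ** L (snd r) = \<tau> *\<^sub>R (L (snd r') ** Bloc A L r')"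
      using Bp(4) r' by auto
    have "A j ** G = \<sigma> *\<^sub>R (A j ** L (snd r) ** N ** H)"
      unfolding Suc.prems(4) by (simp only: matrix_mult_scaleR_right matrix_mul_assoc)
    also have "\<dots> = (\<sigma> * \<tau>) *\<^sub>R (L (snd r') ** (Bloc A L r' ** N) ** H)"
      unfolding \<tau>(2) by (simp add: matrix_mul_assoc scalar_matrix_assoc scalar_mult_eq_scaleR)
    finally have G: "A j ** G = (\<sigma> * \<tau>) *\<^sub>R (L (snd r') ** (Bloc A L r' ** N) ** H)" .
    have "\<sigma> * \<tau> = 1 \<or> \<sigma> * \<tau> = - 1" using Suc.prems(3) \<tau>(1) by auto
    from Suc.IH[OF r'(1) pos_mat_mult[OF Bp(1) Suc.prems(2)] this G]
    have "\<bar>?X n r' ((Bloc A L r' ** N) *v ones) - ?Y n (fst (snd r')) (A j ** G)\<bar> \<le> c" .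
    then show ?thesis using r' by (simp add: matrix_vector_mul_assoc r'_def)
  qed
  have "?X (Suc n) r (N *v ones) - ?Y (Suc n) (fst (snd r)) G
     = (\<Sum>j\<in>UNIV. P (fst (snd r)) j *
         (?X n (next_state A M r j) (Bloc A L (next_state A M r j) *v (N *v ones)) - ?Y n j (A j ** G)))"
    unfolding step_mean_Suc Qmat_sum[OF Suc.prems(1)] by (simp add: right_diff_distrib sum_subtractf)
  also have "\<bar>\<dots>\<bar> \<le> (\<Sum>j\<in>UNIV. P (fst (snd r)) j * c)"
  proof (intro order_trans[OF sum_abs] sum_mono)
    fix j
    show "\<bar>P (fst (snd r)) j *
         (?X n (next_state A M r j) (Bloc A L (next_state A M r j) *v (N *v ones)) - ?Y n j (A j ** G))\<bar>
      \<le> P (fst (snd r)) j * c"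
      using bound[of j] P(1)[of "fst (snd r)" j]
      by (cases "P (fst (snd r)) j = 0") (simp_all only: abs_mult abs_of_nonneg less_le mult_left_mono mult_zero_left abs_zero, auto)
  qed
  also have "\<dots> = c" using P(2) by (simp flip: sum_distrib_right)
  finally show ?case .
qed

lemma local_growth:
  assumes growth: "\<And>i. (\<lambda>n. (step_mean UNIV P (\<lambda>j G. A j ** G) ^^ n) (\<lambda>j G. ln (norm G)) i (A i) / real n) \<longlonglongrightarrow> lam"
    and r: "r \<in> C" and N: "pos_mat N" "det N \<noteq> 0"
  shows "(\<lambda>n. (step_mean C (Qmat P) (\<lambda>r v. Bloc A L r *v v) ^^ n) (\<lambda>r v. ln (sum_coords v)) r (N *v ones) / real n) \<longlonglongrightarrow> lam"
proof -
  \<comment> \<open>Chosen so that \<open>L (snd r) ** N ** H\<close> is exactly the first factor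
    \<open>A (fst (snd r))\<close> of the base product.\<close>
  define H where "H = matrix_inv (L (snd r) ** N) ** A (fst (snd r))"
  have "invertible (L (snd r) ** N)"
    using Bloc_properties(3)[OF mc GL ch C_subset[OF r]] N(2) by (simp add: invertible_det_nz det_mul)
  note LN = matrix_inv_inverse[OF this]
  have H: "invertible H" unfolding H_def using LN(3) GL by (simp add: invertible_mult)
  have "\<exists>c\<ge>0. \<forall>N. pos_mat N \<longrightarrow> \<bar>ln (sum_coords (N *v ones)) - ln (norm (L (snd s) ** N ** H))\<bar> \<le> c"
    if "s \<in> C" for s
    using log_norm_comparison[OF Bloc_properties(3)[OF mc GL ch C_subset[OF that]] H] by metis
  then obtain c where c: "\<And>s. s \<in> C \<Longrightarrow> 0 \<le> c s"
      "\<And>s N. s \<in> C \<Longrightarrow> pos_mat N \<Longrightarrow> \<bar>ln (sum_coords (N *v ones)) - ln (norm (L (snd s) ** N ** H))\<bar> \<le> c s"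
    by metis
  let ?X = "\<lambda>n. (step_mean C (Qmat P) (\<lambda>r v. Bloc A L r *v v) ^^ n) (\<lambda>r v. ln (sum_coords v)) r (N *v ones)"
  let ?Y = "\<lambda>n. (step_mean UNIV P (\<lambda>j G. A j ** G) ^^ n) (\<lambda>j G. ln (norm G)) (fst (snd r)) (A (fst (snd r)))"
  have b: "\<bar>?X n - ?Y n\<bar> \<le> sum c C" for n
  proof (rule local_global_comparison[where H = H and \<sigma> = 1])
    show "\<bar>ln (sum_coords (N *v ones)) - ln (norm (L (snd s) ** N ** H))\<bar> \<le> sum c C"
      if "s \<in> C" "pos_mat N" for s N
      using c(2)[OF that] member_le_sum[OF that(1), of c] c(1) finite_recurrent_class by fastforce
    show "A (fst (snd r)) = 1 *\<^sub>R (L (snd r) ** N ** H)"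
      unfolding H_def using LN(1) by (simp add: matrix_mul_assoc)
  qed (use r N in auto)
  have "(\<lambda>n. ?X n / real n - ?Y n / real n) \<longlonglongrightarrow> 0"
  proof (rule Lim_null_comparison[OF _ lim_const_over_n[of "sum c C"]])
    show "\<forall>\<^sub>F n in sequentially. norm (?X n / real n - ?Y n / real n) \<le> sum c C / real n"
      using b by (intro always_eventually allI) (simp add: divide_right_mono flip: diff_divide_distrib)
  qed
  from tendsto_add[OF this growth[of "fst (snd r)"]] show ?thesis by simp
qed

end

section \<open>The Lyapunov exponent as a mean growth rate\<close>

lemma stationary_vec_pos:
  assumes st: "row_stochastic P" and irr: "irreducible_mat P" and p: "stationary_vec P p"
  shows "0 < p i"
proof -
  have P0: "0 \<le> P i j" and p0: "0 \<le> p i" for i j using st p by (auto simp: row_stochastic_def stationary_vec_def)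
  have mp: "0 \<le> mpow P n i j" for n i j using P0 by (induction n arbitrary: j) (auto intro!: sum_nonneg)
  have inv: "(\<Sum>i\<in>UNIV. p i * mpow P n i j) = p j" for n j
  proof (induction n arbitrary: j)
    case (Suc n)
    have "(\<Sum>i\<in>UNIV. p i * mpow P (Suc n) i j) = (\<Sum>k\<in>UNIV. (\<Sum>i\<in>UNIV. p i * mpow P n i k) * P k j)"
      unfolding mpow.simps sum_distrib_left sum_distrib_right by (subst sum.swap) (simp add: mult.assoc)
    then show ?case using Suc.IH p by (simp add: stationary_vec_def)
  next
    case 0
    have "(\<Sum>i\<in>UNIV. p i * mpow P 0 i j) = (\<Sum>i\<in>UNIV. if i = j then p i else 0)" by (intro sum.cong) auto
    then show ?case by (simp only: sum.delta finite) simp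
  qed
  have "\<exists>k. p k \<noteq> 0" using p unfolding stationary_vec_def by (metis sum.neutral zero_neq_one)
  then obtain k where k: "0 < p k" using p0 by (metis less_le)
  obtain n where "0 < mpow P n k i" using irr unfolding irreducible_mat_def by blast
  then have "0 < p k * mpow P n k i" using k by simp
  also have "\<dots> \<le> (\<Sum>j\<in>UNIV. p j * mpow P n j i)" using p0 mp by (intro member_le_sum) auto
  finally show ?thesis unfolding inv .
qed

lemma cocycle_eq_fold_stake:
  "cocycle A (\<lambda>k. \<omega> !! k) n = fold (\<lambda>i G. A i ** G) (stake n \<omega>) (mat 1)"
proof -
  have "stake n \<omega> = map (\<lambda>k. \<omega> !! k) [0..<n]" by (intro nth_equalityI) auto
  then show ?thesis by (simp add: cocycle_def fold_map o_def)
qed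

lemma integral_stake:
  fixes f :: "'x::finite list \<Rightarrow> real"
  assumes "prob_space \<mu>" and S: "sets \<mu> = sets (stream_space (count_space (UNIV :: 'x set)))"
  shows "(\<lambda>\<omega>. f (stake n \<omega>)) \<in> borel_measurable \<mu>"
    and "(\<integral>\<omega>. f (stake n \<omega>) \<partial>\<mu>)
      = (\<Sum>l\<in>{l. set l \<subseteq> UNIV \<and> length l = n}. f l * measure \<mu> {\<omega> \<in> space \<mu>. stake n \<omega> = l})"
proof -
  interpret prob_space \<mu> by fact
  have stake: "stake n \<in> measurable \<mu> (count_space UNIV)"
    using measurable_stake measurable_cong_sets[OF S refl] by blast
  then show "(\<lambda>\<omega>. f (stake n \<omega>)) \<in> borel_measurable \<mu>"
    by (rule measurable_compose) simp
  let ?N = "{l :: 'x list. set l \<subseteq> UNIV \<and> length l = n}"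
  have fin: "finite ?N" by (rule finite_lists_length_eq) simp
  have m: "{\<omega> \<in> space \<mu>. stake n \<omega> = l} \<in> sets \<mu>" for l
    using measurable_sets[OF stake, of "{l}"] by (simp add: vimage_def Int_def conj_commute)
  have "f (stake n \<omega>) = (\<Sum>l\<in>?N. f l * indicat_real {\<omega> \<in> space \<mu>. stake n \<omega> = l} \<omega>)" if "\<omega> \<in> space \<mu>" for \<omega>
  proof -
    have "(\<Sum>l\<in>?N. f l * indicat_real {\<omega> \<in> space \<mu>. stake n \<omega> = l} \<omega>)
       = (\<Sum>l\<in>?N. if l = stake n \<omega> then f l else 0)"
      using that by (intro sum.cong) (auto simp: indicator_def)
    then show ?thesis using fin by (simp add: sum.delta)
  qed
  then have "(\<integral>\<omega>. f (stake n \<omega>) \<partial>\<mu>) = (\<integral>\<omega>. (\<Sum>l\<in>?N. f l * indicat_real {\<omega> \<in> space \<mu>. stake n \<omega> = l} \<omega>) \<partial>\<mu>)"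
    by (intro Bochner_Integration.integral_cong refl)
  also have "\<dots> = (\<Sum>l\<in>?N. \<integral>\<omega>. f l * indicat_real {\<omega> \<in> space \<mu>. stake n \<omega> = l} \<omega> \<partial>\<mu>)"
    by (rule Bochner_Integration.integral_sum) (use m in \<open>auto simp: integrable_indicator_iff less_top[symmetric]\<close>)
  also have "\<dots> = (\<Sum>l\<in>?N. f l * measure \<mu> {\<omega> \<in> space \<mu>. stake n \<omega> = l})"
    using m by (intro sum.cong refl) (simp add: Int_absorb2 sets.sets_into_space)
  finally show "(\<integral>\<omega>. f (stake n \<omega>) \<partial>\<mu>) = (\<Sum>l\<in>?N. f l * measure \<mu> {\<omega> \<in> space \<mu>. stake n \<omega> = l})" .
qed

text \<open>Linear growth of the logarithm in both directions, the lower bound coming from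
  invertibility. It supplies the integrable majorant for dominated convergence.\<close>

lemma fold_matrix_log_bound:
  fixes A :: "'x::finite \<Rightarrow> real^2^2"
  assumes "\<forall>i. invertible (A i)"
  obtains b where "0 \<le> b" "\<And>l. \<bar>ln (norm (fold (\<lambda>i G. A i ** G) l (mat 1)))\<bar> \<le> b * (1 + real (length l))"
proof -
  have "\<exists>c. 1 \<le> c \<and> (\<forall>G::real^2^2. norm (A i ** G) \<le> c * norm G \<and> norm G \<le> c * norm (A i ** G))" for i
  proof -
    have inv: "invertible (mat 1 :: real^2^2)" by (simp add: invertible_det_nz)
    then show ?thesis
      using matrix_sandwich_norm_bounds[OF assms[rule_format, of i] inv] by simp
  qed
  then obtain c where c: "\<And>i. 1 \<le> c i" "\<And>i G. norm (A i ** (G::real^2^2)) \<le> c i * norm G" "\<And>i G. norm (G::real^2^2) \<le> c i * norm (A i ** G)"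
    by metis
  define b where "b = (\<Sum>i\<in>UNIV. ln (c i))"
  have b: "ln (c i) \<le> b" for i unfolding b_def using c(1) by (intro member_le_sum) auto
  have step: "G \<noteq> 0 \<Longrightarrow> A i ** G \<noteq> 0 \<and> \<bar>ln (norm (A i ** G)) - ln (norm G)\<bar> \<le> b" for i and G :: "real^2^2"
  proof -
    assume G: "G \<noteq> 0"
    then have nz: "A i ** G \<noteq> 0" using c(3)[of G i] by auto
    then have "\<bar>ln (norm (A i ** G)) - ln (norm G)\<bar> \<le> ln (c i)"
      using G c by (intro ln_diff_bound) auto
    then show ?thesis using nz b[of i] by linarith
  qed
  have fold: "\<bar>ln (norm (fold (\<lambda>i G. A i ** G) l G)) - ln (norm G)\<bar> \<le> b * real (length l)" if "G \<noteq> 0" for l and G :: "real^2^2"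
    using that
  proof (induction l arbitrary: G)
    case (Cons i l)
    have s: "A i ** G \<noteq> 0" "\<bar>ln (norm (A i ** G)) - ln (norm G)\<bar> \<le> b" using step[OF Cons.prems, of i] by auto
    have "b * real (length (i # l)) = b + b * real (length l)" by (simp add: algebra_simps)
    then show ?case using s(2) Cons.IH[OF s(1)] unfolding fold.simps o_apply by linarith
  qed simp
  define k where "k = \<bar>ln (norm (mat 1 :: real^2^2))\<bar>"
  have b0: "0 \<le> b" unfolding b_def using c(1) by (intro sum_nonneg) auto
  have m0: "(mat 1 :: real^2^2) \<noteq> 0" by (simp add: vec_eq_iff mat_def forall_2)
  have "\<bar>ln (norm (fold (\<lambda>i G. A i ** G) l (mat 1)))\<bar> \<le> (b + k) * (1 + real (length l))" for l
  proof -
    have "\<bar>ln (norm (fold (\<lambda>i G. A i ** G) l (mat 1)))\<bar> \<le> b * real (length l) + k"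
      using fold[OF m0, of l] unfolding k_def by linarith
    also have "\<dots> \<le> (b + k) * (1 + real (length l))" using b0 by (simp add: algebra_simps k_def)
    finally show ?thesis .
  qed
  then show thesis using b0 by (intro that[of "b + k"]) (auto simp: k_def)
qed

lemma markov_measure_cons:
  assumes "markov_measure P p \<mu>"
  shows "measure \<mu> {\<omega> \<in> space \<mu>. stake (Suc (length l)) \<omega> = i # l} = p i * path_weight P i l"
proof -
  have "measure \<mu> {\<omega> \<in> space \<mu>. stake (length (i # l)) \<omega> = i # l}
      = p (hd (i # l)) * (\<Prod>k<length (i # l) - 1. P ((i # l) ! k) ((i # l) ! Suc k))"
    using assms unfolding markov_measure_def by blast
  then show ?thesis by (simp add: path_weight_eq_prod)
qed

lemma markov_mean_growth:
  fixes P :: "'x::finite \<Rightarrow> 'x \<Rightarrow> real" and A :: "'x \<Rightarrow> real^2^2"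
  assumes st: "row_stochastic P" and irr: "irreducible_mat P" and p: "stationary_vec P p"
    and mu: "markov_measure P p \<mu>"
    and lyap: "AE \<omega> in \<mu>. (\<lambda>n. ln (norm (cocycle A (\<lambda>k. \<omega> !! k) n)) / real n) \<longlonglongrightarrow> lam"
    and GL: "\<forall>i. invertible (A i)"
  shows "(\<lambda>n. (step_mean UNIV P (\<lambda>j G. A j ** G) ^^ n) (\<lambda>j G. ln (norm G)) i (A i) / real n) \<longlonglongrightarrow> lam"
proof -
  have ps: "prob_space \<mu>" and S: "sets \<mu> = sets (stream_space (count_space UNIV))"
    using mu by (auto simp: markov_measure_def)
  interpret prob_space \<mu> by fact
  define W where "W l = ln (norm (fold (\<lambda>i G. A i ** G) l (mat 1)))" for l
  \<comment> \<open>Cutting down to words that begin with \<open>i\<close> isolates the paths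
    started at \<open>i\<close>. The words have length \<open>Suc n\<close>, because
    \<open>?Y n\<close> starts from the factor \<open>A i\<close> and then makes \<open>n\<close>
    moves.\<close>
  define f where "f n l = (if l \<noteq> [] \<and> hd l = i then W l / real (Suc n) else 0)" for n and l :: "'x list"
  let ?Y = "\<lambda>n. (step_mean UNIV P (\<lambda>j G. A j ** G) ^^ n) (\<lambda>j G. ln (norm G)) i (A i)"
  obtain b where b: "0 \<le> b" "\<And>l. \<bar>W l\<bar> \<le> b * (1 + real (length l))"
    unfolding W_def using fold_matrix_log_bound[OF GL] by blast
  have int: "(\<integral>\<omega>. f n (stake (Suc n) \<omega>) \<partial>\<mu>) = p i * ?Y n / real (Suc n)" for n
  proof -
    have "(\<integral>\<omega>. f n (stake (Suc n) \<omega>) \<partial>\<mu>)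
      = (\<Sum>j\<in>UNIV. \<Sum>l\<in>{l. set l \<subseteq> UNIV \<and> length l = n}. f n (j # l) * measure \<mu> {\<omega> \<in> space \<mu>. stake (Suc n) \<omega> = j # l})"
      unfolding integral_stake(2)[OF ps S] by (rule sum_lists_Suc) simp
    also have "\<dots> = (\<Sum>j\<in>UNIV. if j = i then \<Sum>l\<in>{l. set l \<subseteq> UNIV \<and> length l = n}. f n (i # l) * (p i * path_weight P i l) else 0)"
    proof (intro sum.cong refl)
      fix j
      have "f n (j # l) * measure \<mu> {\<omega> \<in> space \<mu>. stake (Suc n) \<omega> = j # l}
         = (if j = i then f n (i # l) * (p i * path_weight P i l) else 0)" if "length l = n" for l
        using markov_measure_cons[OF mu, of l j] that by (auto simp: f_def)
      then show "(\<Sum>l\<in>{l. set l \<subseteq> UNIV \<and> length l = n}. f n (j # l) * measure \<mu> {\<omega> \<in> space \<mu>. stake (Suc n) \<omega> = j # l})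
         = (if j = i then \<Sum>l\<in>{l. set l \<subseteq> UNIV \<and> length l = n}. f n (i # l) * (p i * path_weight P i l) else 0)"
        by (cases "j = i") (auto simp del: stake.simps intro!: sum.cong sum.neutral)
    qed
    also have "\<dots> = (\<Sum>l\<in>{l. set l \<subseteq> UNIV \<and> length l = n}. f n (i # l) * (p i * path_weight P i l))"
      by (simp add: sum.delta)
    also have "\<dots> = p i * ?Y n / real (Suc n)"
      unfolding step_mean_funpow[OF finite] sum_distrib_left sum_divide_distrib
      by (intro sum.cong refl) (simp add: f_def W_def)
    finally show ?thesis .
  qed
  let ?g = "\<lambda>\<omega>. if hd (stake 1 \<omega>) = i then lam else 0"
  have "(\<lambda>n. \<integral>\<omega>. f n (stake (Suc n) \<omega>) \<partial>\<mu>) \<longlonglongrightarrow> (\<integral>\<omega>. ?g \<omega> \<partial>\<mu>)"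
  proof (rule integral_dominated_convergence[where w = "\<lambda>_. 2 * b"])
    show "?g \<in> borel_measurable \<mu>"
      by (rule integral_stake(1)[OF ps S, where f = "\<lambda>l. if hd l = i then lam else 0"])
    show "\<And>n. (\<lambda>\<omega>. f n (stake (Suc n) \<omega>)) \<in> borel_measurable \<mu>"
      by (rule integral_stake(1)[OF ps S])
    show "AE \<omega> in \<mu>. norm (f n (stake (Suc n) \<omega>)) \<le> 2 * b" for n
    proof (rule AE_I2)
      fix \<omega>
      have "\<bar>W (stake (Suc n) \<omega>)\<bar> \<le> b * (1 + real (Suc n))" using b(2)[of "stake (Suc n) \<omega>"] by (simp only: length_stake)
      also have "\<dots> \<le> b * (2 * real (Suc n))" using b(1) by (intro mult_left_mono) auto
      finally have "\<bar>W (stake (Suc n) \<omega>)\<bar> / real (Suc n) \<le> 2 * b" by (simp add: divide_le_eq mult_ac)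
      then show "norm (f n (stake (Suc n) \<omega>)) \<le> 2 * b" using b(1) by (simp add: f_def abs_divide del: stake.simps)
    qed
    show "AE \<omega> in \<mu>. (\<lambda>n. f n (stake (Suc n) \<omega>)) \<longlonglongrightarrow> ?g \<omega>"
      using lyap
    proof eventually_elim
      case (elim \<omega>)
      then have "(\<lambda>n. W (stake (Suc n) \<omega>) / real (Suc n)) \<longlonglongrightarrow> lam"
        unfolding cocycle_eq_fold_stake W_def[symmetric] by (rule LIMSEQ_Suc)
      then show ?case by (auto simp: f_def simp del: of_nat_Suc) 
    qed
  qed simp
  moreover have "(\<integral>\<omega>. ?g \<omega> \<partial>\<mu>) = p i * lam"
  proof -
    have "(\<integral>\<omega>. ?g \<omega> \<partial>\<mu>) = (\<Sum>l\<in>{l. set l \<subseteq> UNIV \<and> length l = 1}. (if hd l = i then lam else 0) * measure \<mu> {\<omega> \<in> space \<mu>. stake 1 \<omega> = l})"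
      by (rule integral_stake(2)[OF ps S, where f = "\<lambda>l. if hd l = i then lam else 0"])
    also have "{l :: 'x list. set l \<subseteq> UNIV \<and> length l = 1} = (\<lambda>j. [j]) ` UNIV" by (auto simp: length_Suc_conv)
    also have "(\<Sum>l\<in>(\<lambda>j. [j]) ` UNIV. (if hd l = i then lam else 0) * measure \<mu> {\<omega> \<in> space \<mu>. stake 1 \<omega> = l})
       = (\<Sum>j\<in>UNIV. (if j = i then lam else 0) * p j)"
      using markov_measure_cons[OF mu, of "[]"] by (subst sum.reindex) (auto simp: inj_on_def)
    also have "\<dots> = (\<Sum>j\<in>UNIV. if j = i then lam * p i else 0)" by (intro sum.cong) auto
    finally show ?thesis by (simp add: sum.delta)
  qed
  ultimately have "(\<lambda>n. p i * ?Y n / real (Suc n)) \<longlonglongrightarrow> p i * lam" unfolding int by simp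
  \<comment> \<open>Positivity of \<open>p i\<close> permits the division, and the factor
    \<open>Suc n / n\<close> corrects the normalisation; at \<open>n = 0\<close> both sides of the
    later identity are zero by division by zero.\<close>
  from tendsto_mult[OF tendsto_divide[OF this tendsto_const[of "p i"]] LIMSEQ_Suc_n_over_n]
  have "(\<lambda>n. p i * ?Y n / real (Suc n) / p i * (real (Suc n) / real n)) \<longlonglongrightarrow> lam"
    using stationary_vec_pos[OF st irr p, of i] by simp
  moreover have "p i * ?Y n / real (Suc n) / p i * (real (Suc n) / real n) = ?Y n / real n" for n
    using stationary_vec_pos[OF st irr p, of i] by simp
  ultimately show ?thesis by (simp only:)
qed

theorem theorem3p14:
  fixes P :: "'x::finite \<Rightarrow> 'x \<Rightarrow> real"
    and p :: "'x \<Rightarrow> real"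
    and A :: "'x \<Rightarrow> real^2^2"
    and \<mu> :: "'x stream measure"
    and lam :: real
    and M :: "'x \<Rightarrow> rp1 set"
    and L :: "'x \<times> rp1 set \<Rightarrow> real^2^2"
    and C :: "(('x \<times> rp1 set) \<times> ('x \<times> rp1 set)) set"
    and rs :: "('x \<times> rp1 set) \<times> ('x \<times> rp1 set)"
    and \<pi> :: "(('x \<times> rp1 set) \<times> ('x \<times> rp1 set)) list \<Rightarrow> real"
  assumes stoch: "row_stochastic P"
    and irred: "irreducible_mat P"
    and stat: "stationary_vec P p"
    and mu: "markov_measure P p \<mu>"
    and lyap: "AE \<omega> in \<mu>. (\<lambda>n. ln (norm (cocycle A (\<lambda>k. \<omega> !! k) n)) / real n) \<longlonglongrightarrow> lam"
    and GL2: "\<forall>i. invertible (A i)"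
    and hyp: "proj_unif_hyp P A"
    and mc: "multicone P A M"
    and charts: "local_charts M L"
    and rec: "recurrent_class P A M C"
    and rs: "rs \<in> C"
    and pi: "stationary_on (redC C (Qmat P) rs) (redQ (Qmat P)) \<pi>"
  shows "(\<lambda>n. coord0 (redC C (Qmat P) rs) \<pi>
            ((Top (redC C (Qmat P) rs) (redQ (Qmat P)) \<pi> (redB (Bloc A L)) ^^ n)
               (\<lambda>s k. seed (redC C (Qmat P) rs) (redQ (Qmat P)) \<pi> (redB (Bloc A L)) s k
                      / of_nat (period C (Qmat P) rs))))
         sums (of_real lam)"
proof -
  note ctxt = stoch GL2 mc charts rec
  interpret recurrent_chain C "Qmat P" rs by (rule recurrent_chain_Qmat[OF ctxt rs])
  have Bloc: "pos_mat (Bloc A L r)" "det (Bloc A L r) \<noteq> 0" if "r \<in> C" for r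
    using Bloc_properties[OF mc GL2 charts C_subset[OF ctxt that]] by auto
  have growth: "(\<lambda>n. log_growth (redC C (Qmat P) rs) (redQ (Qmat P)) (redB (Bloc A L)) n c ones / real n)
      \<longlonglongrightarrow> real d * lam" if "c \<in> redC C (Qmat P) rs" for c
    by (rule reduced_log_growth[OF local_growth[OF ctxt markov_mean_growth[OF stoch irred stat mu lyap GL2]] Bloc that])
  have "pos_mat (redB (Bloc A L) c)" if "c \<in> redC C (Qmat P) rs" for c
    using redC_D[OF that] Bloc by (intro pos_mat_redB) auto
  \<comment> \<open>The reduced chain grows at the rate \<open>d * lam\<close>, and the factor
    \<open>1 / d\<close> of the seed undoes this.\<close>
  from coord0_series_sums[OF finite_redC redQ_nonneg redQ_row_sum this pi growth, where d = d]
  show ?thesis using period_pos by simp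
qed

end
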